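(* Let $f:\mathbb{R}\to(0,\infty)$ be a continuous density that is nonincreasing on $(-\infty,0]$ and nondecreasing on $[0,\infty)$. Let $n\ge 1$ and let $V_1\le V_2\le\dots\le V_n$ be positive prescribed volumes. Then every perimeter-minimizing $n$-bubble on $\mathbb{R}$ with density $f$ and prescribed volumes $V_1,\dots,V_n$ is a standard nested bubble (i.e. a standard nested bubble of type $(k_1,\dots,k_m)$ for some positive integers $k_1,\dots,k_m$).
   Context: A density on $\mathbb{R}$ is a function $f:\mathbb{R}\to(0,\infty)$; the volume of a set $E$ is $\int_E f\,dx$. An $n$-bubble with prescribed volumes $V_1,\dots,V_n$ is an $n$-tuple of sets $(E_1,\dots,E_n)$ with pairwise disjoint interiors, each a finite union of compact intervals of positive length, such that $E_a$ has volume $V_a$; $E_a$ is called bubble $a$. The components of bubble $a$ are the connected components (maximal intervals) of $E_a$; the components of the $n$-bubble are all of these. The boundary points are the points of $\bigcup_a\partial E_a$ (each counted once), and the perimeter is the sum of $f(x)$ over all boundary points $x$. An $n$-bubble is perimeter minimizing if its perimeter is minimal among all $n$-bubbles with the same prescribed volumes. Components are contiguous if, listed from left to right, the right endpoint of each is the left endpoint of the next. A standard $n$-bubble is an $n$-bubble with contiguous components, in which every bubble has exactly one component, and which is in equilibrium. Here "in equilibrium" means being a local minimizer of the perimeter functional: no sufficiently small displacement of the boundary points that preserves the volumes of all bubbles decreases the perimeter. Let $k_1,\dots,k_m$ be positive integers. An $n$-bubble $B$ is a standard nested bubble of type $(k_1,\dots,k_m)$ if there are standard $k_i$-bubbles $B_i$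 ($1\le i\le m$) with pairwise disjoint sets of boundary points such that: (1) the boundary points of $B$ consist exactly of the boundary points of the $B_i$'s; (2) $B_{i+1}$ is contained in a single component of $B_i$ for each $1\le i<m$; (3) in $B$, for each $i>1$, the component of $B$ immediately to the left of $B_i$ and the component of $B$ immediately to the right of $B_i$ together form a single bubble of $B$, and no other bubbles of $B$ have more than one component. *)

theory Defs
  imports "HOL-Analysis.Analysis"
begin

text \<open>
  An \<open>n\<close>-bubble is represented by a family \<open>E :: nat \<Rightarrow> real set\<close> of which only the members
  \<open>E 1, \<dots>, E n\<close> matter.
\<close>

definition is_density :: "(real \<Rightarrow> real) \<Rightarrow> bool" where
  "is_density f \<longleftrightarrow> (\<forall>x. f x > 0)"

definition volume :: "(real \<Rightarrow> real) \<Rightarrow> real set \<Rightarrow> real" where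
  "volume f S = integral S f"

definition finite_interval_union :: "real set \<Rightarrow> bool" where
  "finite_interval_union S \<longleftrightarrow>
     (\<exists>\<I>. finite \<I> \<and> (\<forall>I\<in>\<I>. \<exists>a b. a < b \<and> I = {a..b}) \<and> S = \<Union>\<I>)"

definition is_bubble :: "nat \<Rightarrow> (nat \<Rightarrow> real set) \<Rightarrow> bool" where
  "is_bubble n E \<longleftrightarrow>
     (\<forall>a\<in>{1..n}. finite_interval_union (E a)) \<and>
     (\<forall>a\<in>{1..n}. \<forall>b\<in>{1..n}. a \<noteq> b \<longrightarrow> interior (E a) \<inter> interior (E b) = {})"

definition is_bubble_with_volumes ::
  "(real \<Rightarrow> real) \<Rightarrow> nat \<Rightarrow> (nat \<Rightarrow> real) \<Rightarrow> (nat \<Rightarrow> real set) \<Rightarrow> bool" where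
  "is_bubble_with_volumes f n V E \<longleftrightarrow> is_bubble n E \<and> (\<forall>a\<in>{1..n}. volume f (E a) = V a)"

definition bubble_components :: "nat \<Rightarrow> (nat \<Rightarrow> real set) \<Rightarrow> real set set" where
  "bubble_components n E = (\<Union>a\<in>{1..n}. components (E a))"

definition boundary_points :: "nat \<Rightarrow> (nat \<Rightarrow> real set) \<Rightarrow> real set" where
  "boundary_points n E = (\<Union>a\<in>{1..n}. frontier (E a))"

definition region :: "nat \<Rightarrow> (nat \<Rightarrow> real set) \<Rightarrow> real set" where
  "region n E = (\<Union>a\<in>{1..n}. E a)"

definition perimeter :: "(real \<Rightarrow> real) \<Rightarrow> nat \<Rightarrow> (nat \<Rightarrow> real set) \<Rightarrow> real" where
  "perimeter f n E = (\<Sum>x\<in>boundary_points n E. f x)"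

definition perimeter_minimizing ::
  "(real \<Rightarrow> real) \<Rightarrow> nat \<Rightarrow> (nat \<Rightarrow> real) \<Rightarrow> (nat \<Rightarrow> real set) \<Rightarrow> bool" where
  "perimeter_minimizing f n V E \<longleftrightarrow>
     is_bubble_with_volumes f n V E \<and>
     (\<forall>F. is_bubble_with_volumes f n V F \<longrightarrow> perimeter f n E \<le> perimeter f n F)"

definition contiguous :: "nat \<Rightarrow> (nat \<Rightarrow> real set) \<Rightarrow> bool" where
  "contiguous n E \<longleftrightarrow>
     (\<exists>Cs. set Cs = bubble_components n E \<and> sorted_wrt (\<lambda>C D. Inf C < Inf D) Cs \<and>
           (\<forall>j. Suc j < length Cs \<longrightarrow> Sup (Cs ! j) = Inf (Cs ! Suc j)))"

text \<open>
  A displacement moves each boundary point \<open>x\<close> to \<open>\<phi> x\<close>, so that a boundary point shared by two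
  components remains shared. A component \<open>[p, q]\<close> becomes \<open>[\<phi> p, \<phi> q]\<close>.
\<close>

definition displace :: "(real \<Rightarrow> real) \<Rightarrow> (nat \<Rightarrow> real set) \<Rightarrow> nat \<Rightarrow> real set" where
  "displace \<phi> E a = (\<Union>C\<in>components (E a). {\<phi> (Inf C)..\<phi> (Sup C)})"

text \<open>
  The displaced family need not be required to be an \<open>n\<close>-bubble again: this is automatic once
  \<open>\<epsilon>\<close> is at most half the least distance between boundary points, and replacing \<open>\<epsilon>\<close> by a smaller
  positive number only weakens the condition on \<open>E\<close>.
\<close>

definition in_equilibrium :: "(real \<Rightarrow> real) \<Rightarrow> nat \<Rightarrow> (nat \<Rightarrow> real set) \<Rightarrow> bool" where
  "in_equilibrium f n E \<longleftrightarrow>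
     (\<exists>\<epsilon>>0. \<forall>\<phi>.
        (\<forall>x\<in>boundary_points n E. \<bar>\<phi> x - x\<bar> < \<epsilon>) \<longrightarrow>
        (\<forall>a\<in>{1..n}. volume f (displace \<phi> E a) = volume f (E a)) \<longrightarrow>
        perimeter f n E \<le> perimeter f n (displace \<phi> E))"

definition standard_bubble :: "(real \<Rightarrow> real) \<Rightarrow> nat \<Rightarrow> (nat \<Rightarrow> real set) \<Rightarrow> bool" where
  "standard_bubble f n E \<longleftrightarrow>
     is_bubble n E \<and> contiguous n E \<and> (\<forall>a\<in>{1..n}. card (components (E a)) = 1) \<and>
     in_equilibrium f n E"

text \<open>
  Bubble \<open>a\<close> consists of the component of the \<open>n\<close>-bubble \<open>E\<close> immediately to the left of \<open>S\<close>
  together with the one immediately to the right of \<open>S\<close>; ``immediately'' means that they touch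
  \<open>S\<close> at its left and right end.
\<close>

definition flanks :: "nat \<Rightarrow> (nat \<Rightarrow> real set) \<Rightarrow> real set \<Rightarrow> nat \<Rightarrow> bool" where
  "flanks n E S a \<longleftrightarrow>
     (\<exists>C\<in>bubble_components n E. \<exists>D\<in>bubble_components n E.
        Sup C = Inf S \<and> Inf D = Sup S \<and> E a = C \<union> D)"

definition standard_nested_bubble ::
  "(real \<Rightarrow> real) \<Rightarrow> nat \<Rightarrow> (nat \<Rightarrow> real set) \<Rightarrow> nat \<Rightarrow> (nat \<Rightarrow> nat) \<Rightarrow> bool" where
  "standard_nested_bubble f n E m k \<longleftrightarrow>
     is_bubble n E \<and>
     (\<exists>B :: nat \<Rightarrow> nat \<Rightarrow> real set.
        (\<forall>i\<in>{1..m}. standard_bubble f (k i) (B i)) \<and>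
        (\<forall>i\<in>{1..m}. \<forall>j\<in>{1..m}. i \<noteq> j \<longrightarrow>
           boundary_points (k i) (B i) \<inter> boundary_points (k j) (B j) = {}) \<and>
        boundary_points n E = (\<Union>i\<in>{1..m}. boundary_points (k i) (B i)) \<and>
        (\<forall>i\<in>{1..<m}. \<exists>C\<in>bubble_components (k i) (B i).
           region (k (Suc i)) (B (Suc i)) \<subseteq> C) \<and>
        (\<forall>i\<in>{2..m}. \<exists>a\<in>{1..n}. flanks n E (region (k i) (B i)) a) \<and>
        (\<forall>a\<in>{1..n}. (\<forall>i\<in>{2..m}. \<not> flanks n E (region (k i) (B i)) a) \<longrightarrow>
           card (components (E a)) \<le> 1))"

end

theory Submission
  imports Defs
begin

text \<open>
  Measure position on the line by volume: with \<open>F\<close> the antiderivative of \<open>f\<close> vanishing at \<open>0\<close>, a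
  point \<open>x\<close> gets the coordinate \<open>F x\<close>. An \<open>n\<close>-bubble becomes a finite increasing sequence of cuts
  together with a colour for each cell between consecutive cuts (the index of the bubble, or \<open>0\<close> for
  a gap), the volume of a bubble is the total length of its cells, and the perimeter is the sum of
  \<open>g = f \<circ> F\<inverse>\<close> over the cuts, where \<open>g\<close> is nonincreasing up to \<open>0\<close> and nondecreasing from \<open>0\<close> on.

  One family of moves drives everything. If the cells \<open>i < j\<close> have the same colour, all cuts between
  them may be translated by the same amount: cell \<open>i\<close> gains what cell \<open>j\<close> loses
  (\<open>color_volume_shift_cuts\<close>). If moves of this kind bring every cut weakly closer to \<open>0\<close> and make
  two cuts coincide, then no cost increases and one positive cost disappears, which contradicts
  minimality (\<open>no_collapse\<close>). The two unbounded outer regions carry colour \<open>0\<close> as well, so gaps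
  need no separate treatment. This gives, in turn:

    \<^item> two cells of one colour cannot lie on the same side of \<open>0\<close>
      (\<open>repeated_starts_left\<close>, \<open>repeated_ends_right\<close>);
    \<^item> no colour occurs three times (\<open>no_color_thrice\<close>), and for colour \<open>0\<close> this says that there are
      no gaps;
    \<^item> two repeated colours do not alternate (\<open>no_crossing\<close>).

  Hence the pairs of equally coloured cells form a chain under strict nesting, whose outermost
  member is the pair of outer regions. Between one pair and the next lie the cuts of one layer. The
  intervals into which the cuts of a layer divide their range form one of the standard bubbles:
  a displacement of these cuts alone that preserves the volume between consecutive ones is a
  rigid translation in the volume coordinate, and it extends to a displacement of the whole bubble
  that keeps all volumes, so minimality yields equilibrium (\<open>layers\<close>, \<open>chain_in_equilibrium\<close>).
  The two cells of any pair other than the outermost one flank the layer directly inside them.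
\<close>

section \<open>Coloured cuts\<close>

lemma finite_linorder_enumeration:
  fixes P :: "'a::linorder set"
  assumes "finite P"
  obtains e where "strict_mono_on {1..card P} e" and "P = e ` {1..card P}"
proof -
  define e where "e k = sorted_list_of_set P ! (k - 1)" for k
  have len: "length (sorted_list_of_set P) = card P" by simp
  have "strict_mono_on {1..card P} e"
  proof (rule strict_mono_onI)
    fix r s assume "r \<in> {1..card P}" "s \<in> {1..card P}" "r < s"
    then show "e r < e s"
      unfolding e_def
      by (intro sorted_wrt_nth_less[OF strict_sorted_list_of_set]) auto
  qed
  moreover have "P = e ` {1..card P}"
  proof -
    have "P = set (sorted_list_of_set P)" using assms by simp
    also have "\<dots> = (\<lambda>k. sorted_list_of_set P ! k) ` {..<card P}"
      unfolding set_conv_nth len by auto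
    also have "\<dots> = e ` Suc ` {..<card P}"
      unfolding image_image e_def by simp
    also have "Suc ` {..<card P} = {1..card P}"
      by (metis atLeast0LessThan image_Suc_atLeastLessThan One_nat_def atLeastLessThanSuc_atLeastAtMost)
    finally show ?thesis .
  qed
  ultimately show thesis using that by blast
qed

text \<open>
  The cuts are \<open>w 1, \<dots>, w M\<close>. Cell \<open>k\<close> has \<open>w k\<close> as its left end and \<open>w (Suc k)\<close> as its right
  end, so the bounded cells are those with \<open>1 \<le> k < M\<close>, whereas the cells \<open>0\<close> and \<open>M\<close> are the
  rays outside all cuts.
\<close>

definition color_volume :: "nat \<Rightarrow> (nat \<Rightarrow> nat) \<Rightarrow> (nat \<Rightarrow> real) \<Rightarrow> nat \<Rightarrow> real" where
  "color_volume M c w a = (\<Sum>k | k \<in> {1..<M} \<and> c k = a. w (Suc k) - w k)"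

definition shift_cuts :: "nat \<Rightarrow> nat \<Rightarrow> real \<Rightarrow> (nat \<Rightarrow> real) \<Rightarrow> nat \<Rightarrow> real" where
  "shift_cuts i j d w k = (if i < k \<and> k \<le> j then w k + d else w k)"

text \<open>
  The translated cuts are the ones strictly between the cells \<open>i\<close> and \<open>j\<close>, so only these two cells
  change length, by opposite amounts. An outer ray can only be paired with a gap or with the other
  ray, and neither counts for a colour \<open>a \<noteq> 0\<close>; hence \<open>i = 0\<close> and \<open>j = M\<close> are allowed.
\<close>

lemma color_volume_shift_cuts:
  assumes "i < j" "j \<le> M" "c i = c j" "c 0 = 0" "c M = 0" "a \<noteq> 0"
  shows "color_volume M c (shift_cuts i j d w) a = color_volume M c w a"
proof -
  let ?S = "{k. k \<in> {1..<M} \<and> c k = a}"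
  have "color_volume M c (shift_cuts i j d w) a
      = (\<Sum>k\<in>?S. (w (Suc k) - w k) + ((if k = i then d else 0) - (if k = j then d else 0)))"
    unfolding color_volume_def using \<open>i < j\<close>
    by (intro sum.cong) (auto simp: shift_cuts_def)
  also have "\<dots> = color_volume M c w a + ((if i \<in> ?S then d else 0) - (if j \<in> ?S then d else 0))"
    unfolding color_volume_def sum.distrib sum_subtractf
    by (simp add: sum.delta)
  also have "i \<in> ?S \<longleftrightarrow> j \<in> ?S"
    using assms by (cases "i = 0"; cases "j = M") auto
  finally show ?thesis by simp
qed

lemma mono_on_atLeastAtMost_nat:
  fixes w :: "nat \<Rightarrow> real"
  assumes "\<And>k. 1 \<le> k \<Longrightarrow> k < M \<Longrightarrow> w k \<le> w (Suc k)"
  shows "mono_on {1..M} w"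
proof (rule mono_onI)
  fix r s assume *: "r \<in> {1..M}" "s \<in> {1..M}" "r \<le> s"
  have "r \<le> s \<Longrightarrow> s \<le> M \<Longrightarrow> w r \<le> w s"
  proof (induction s rule: dec_induct)
    case (step s)
    then show ?case using assms[of s] * by fastforce
  qed simp
  with * show "w r \<le> w s" by simp
qed

section \<open>Cuts of least total cost\<close>

text \<open>
  Competitors \<open>w\<close> only have to be weakly increasing. Coinciding cuts are paid for once, since the sum
  on the right-hand side runs over the image of \<open>w\<close>; this is where merging two cuts saves cost.
\<close>

locale minimal_cuts =
  fixes n M :: nat and c :: "nat \<Rightarrow> nat" and v :: "nat \<Rightarrow> real" and g :: "real \<Rightarrow> real"
  assumes cuts_increasing: "strict_mono_on {1..M} v"
    and exterior: "c 0 = 0" "c M = 0"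
    and alternating: "k < M \<Longrightarrow> c k \<noteq> c (Suc k)"
    and cost_pos: "g y > 0"
    and cost_left: "y \<le> z \<Longrightarrow> z \<le> 0 \<Longrightarrow> g z \<le> g y"
    and cost_right: "0 \<le> y \<Longrightarrow> y \<le> z \<Longrightarrow> g y \<le> g z"
    and minimal: "mono_on {1..M} w \<Longrightarrow>
        (\<And>a. a \<in> {1..n} \<Longrightarrow> color_volume M c w a = color_volume M c v a) \<Longrightarrow>
        (\<Sum>k\<in>{1..M}. g (v k)) \<le> (\<Sum>y\<in>w ` {1..M}. g y)"
begin

lemma cut_less: "1 \<le> k \<Longrightarrow> k < l \<Longrightarrow> l \<le> M \<Longrightarrow> v k < v l"
  using cuts_increasing by (auto simp: strict_mono_on_def)

lemma cut_le: "1 \<le> k \<Longrightarrow> k \<le> l \<Longrightarrow> l \<le> M \<Longrightarrow> v k \<le> v l"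
  using cut_less[of k l] by (cases "k = l") auto

text \<open>
  Each cut stays put or moves towards \<open>0\<close> without crossing it, so no single cost increases, and of
  the two merged cuts only one still has to be paid for.
\<close>

lemma no_collapse:
  assumes steps: "\<And>k. 1 \<le> k \<Longrightarrow> k < M \<Longrightarrow> w k \<le> w (Suc k)"
    and vols: "\<And>a. a \<in> {1..n} \<Longrightarrow> color_volume M c w a = color_volume M c v a"
    and cost: "\<And>k. 1 \<le> k \<Longrightarrow> k \<le> M \<Longrightarrow>
      v k \<le> w k \<and> w k \<le> 0 \<or> 0 \<le> w k \<and> w k \<le> v k \<or> w k = v k"
    and merge: "1 \<le> i" "i < M" "w i = w (Suc i)"
  shows False
proof -
  have le: "g (w k) \<le> g (v k)" if "k \<in> {1..M}" for k
    using cost[of k] cost_left[of "v k" "w k"] cost_right[of "w k" "v k"] that by auto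
  have img: "w ` {1..M} = w ` ({1..M} - {i})"
  proof -
    have "w i \<in> w ` ({1..M} - {i})" using merge by (intro image_eqI[of _ _ "Suc i"]) auto
    then show ?thesis by auto
  qed
  have "(\<Sum>k\<in>{1..M}. g (v k)) \<le> (\<Sum>y\<in>w ` {1..M}. g y)"
    by (intro minimal mono_on_atLeastAtMost_nat steps vols)
  also have "\<dots> \<le> (\<Sum>k\<in>{1..M} - {i}. g (w k))"
    unfolding img using sum_image_le[of "{1..M} - {i}" g w] cost_pos
    by (simp add: less_imp_le comp_def)
  also have "\<dots> \<le> (\<Sum>k\<in>{1..M} - {i}. g (v k))"
    by (intro sum_mono le) auto
  also have "\<dots> < (\<Sum>k\<in>{1..M}. g (v k))"
    using merge cost_pos[of "v i"] by (subst sum.remove[of "{1..M}" i]) auto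
  finally show False by simp
qed

lemma vol_shift:
  "i < j \<Longrightarrow> j \<le> M \<Longrightarrow> c i = c j \<Longrightarrow> a \<in> {1..n} \<Longrightarrow>
   color_volume M c (shift_cuts i j d w) a = color_volume M c w a"
  using color_volume_shift_cuts[of i j M c a d w] exterior by auto

text \<open>
  Otherwise the whole cell \<open>i\<close> lies to the right of \<open>0\<close>: handing its entire length over to cell \<open>j\<close>
  moves the cuts in between to the left, towards \<open>0\<close>, and collapses cell \<open>i\<close>.
\<close>

lemma repeated_starts_left:
  assumes "i < j" "j \<le> M" "c i = c j" "1 \<le> i"
  shows "v i < 0"
proof (rule ccontr)
  assume neg: "\<not> v i < 0"
  define w where "w = shift_cuts i j (v i - v (Suc i)) v"
  show False
  proof (rule no_collapse[of w i])
    fix k assume k: "1 \<le> k" "k < M"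
    show "w k \<le> w (Suc k)"
      using k assms cut_less[of k "Suc k"] cut_less[of i "Suc i"]
      by (auto simp: w_def shift_cuts_def not_le less_Suc_eq)
  next
    fix k assume k: "1 \<le> k" "k \<le> M"
    show "v k \<le> w k \<and> w k \<le> 0 \<or> 0 \<le> w k \<and> w k \<le> v k \<or> w k = v k"
      using k assms neg cut_less[of i "Suc i"] cut_le[of "Suc i" k]
      by (auto simp: w_def shift_cuts_def)
  qed (use assms vol_shift in \<open>auto simp: w_def shift_cuts_def\<close>)
qed

lemma repeated_ends_right:
  assumes "i < j" "j < M" "c i = c j"
  shows "0 < v (Suc j)"
proof (rule ccontr)
  assume neg: "\<not> 0 < v (Suc j)"
  define w where "w = shift_cuts i j (v (Suc j) - v j) v"
  show False
  proof (rule no_collapse[of w j])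
    fix k assume k: "1 \<le> k" "k < M"
    show "w k \<le> w (Suc k)"
      using k assms cut_less[of k "Suc k"] cut_less[of j "Suc j"]
      by (auto simp: w_def shift_cuts_def not_le less_Suc_eq)
  next
    fix k assume k: "1 \<le> k" "k \<le> M"
    show "v k \<le> w k \<and> w k \<le> 0 \<or> 0 \<le> w k \<and> w k \<le> v k \<or> w k = v k"
      using k assms neg cut_less[of j "Suc j"] cut_le[of k j]
      by (auto simp: w_def shift_cuts_def)
  qed (use assms vol_shift in \<open>auto simp: w_def shift_cuts_def\<close>)
qed

text \<open>
  By the two preceding lemmas the middle cell \<open>k\<close> contains \<open>0\<close> in its interior. Its part left of \<open>0\<close>
  goes to cell \<open>i\<close> and its part right of \<open>0\<close> to cell \<open>j\<close>, so that both ends of cell \<open>k\<close> move to \<open>0\<close>.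
\<close>

lemma no_color_thrice:
  assumes "i < k" "k < j" "j \<le> M" "c i = c k" "c k = c j"
  shows False
proof -
  have L: "v k < 0" using repeated_starts_left[of k j] assms by auto
  have R: "0 < v (Suc k)" using repeated_ends_right[of i k] assms by auto
  define w where "w = shift_cuts i k (- v k) (shift_cuts k j (- v (Suc k)) v)"
  show False
  proof (rule no_collapse[of w k])
    fix l assume l: "1 \<le> l" "l < M"
    show "w l \<le> w (Suc l)"
      using l assms L R cut_less[of l "Suc l"]
      by (auto simp: w_def shift_cuts_def not_le less_Suc_eq)
  next
    fix l assume l: "1 \<le> l" "l \<le> M"
    show "v l \<le> w l \<and> w l \<le> 0 \<or> 0 \<le> w l \<and> w l \<le> v l \<or> w l = v l"
      using l assms L R cut_le[of "Suc k" l] cut_le[of l k]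
      by (auto simp: w_def shift_cuts_def)
  qed (use assms vol_shift in \<open>auto simp: w_def shift_cuts_def\<close>)
qed

text \<open>
  In an alternating pattern \<open>i < i' < j < j'\<close>, an amount \<open>d\<close> can be transferred from \<open>j\<close> to \<open>i\<close> and
  at the same time from \<open>i'\<close> to \<open>j'\<close>. The cuts between \<open>i'\<close> and \<open>j\<close> take part in both transfers and do
  not move, those between \<open>i\<close> and \<open>i'\<close> move right and those between \<open>j\<close> and \<open>j'\<close> move left, until cell
  \<open>i'\<close> or cell \<open>j\<close> is used up. When \<open>0\<close> lies inside cell \<open>i'\<close> or inside cell \<open>j\<close>, a preliminary shift
  by \<open>e\<close> or \<open>e'\<close> first moves the inner end of that cell to \<open>0\<close>, so that nothing has to cross \<open>0\<close>.
\<close>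

lemma no_crossing:
  assumes order: "i < i'" "i' < j" "j < j'" "j' \<le> M" and same: "c i = c j" "c i' = c j'"
  shows False
proof -
  have L: "v i' < 0" using repeated_starts_left[of i' j'] assms by auto
  have R: "0 < v (Suc j)" using repeated_ends_right[of i j] assms by auto
  define e where "e = max 0 (v (Suc i'))"
  define e' where "e' = max 0 (- v j)"
  have le: "v (Suc i') \<le> v j" using cut_le[of "Suc i'" j] order by auto
  have ee: "e = 0 \<or> e' = 0" using le by (auto simp: e_def e'_def)
  \<comment> \<open>The lengths that cells \<open>i'\<close> and \<open>j\<close> have after the preliminary shift.\<close>
  define d where "d = min (v (Suc i') - e - v i') (v (Suc j) - (v j + e'))"
  define w where "w = shift_cuts i j (d + e') (shift_cuts i' j' (- (d + e)) v)"
  have d0: "0 \<le> d" using L R cut_less[of i' "Suc i'"] cut_less[of j "Suc j"] order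
    by (auto simp: d_def e_def e'_def)
  have d1: "d \<le> v (Suc i') - e - v i'" "d \<le> v (Suc j) - (v j + e')"
    by (auto simp: d_def)
  have e0: "0 \<le> e" "0 \<le> e'" "v (Suc i') \<le> e" "0 \<le> v j + e'" "e \<le> v j + e'" "v (Suc i') + e' \<le> e"
    using ee le L R by (auto simp: e_def e'_def)
  have steps: "w k \<le> w (Suc k)" if k: "1 \<le> k" "k < M" for k
    using k order cut_less[of k "Suc k"] d0 d1 e0
    by (auto simp: w_def shift_cuts_def not_le less_Suc_eq)
  have cost: "v k \<le> w k \<and> w k \<le> 0 \<or> 0 \<le> w k \<and> w k \<le> v k \<or> w k = v k"
    if k: "1 \<le> k" "k \<le> M" for k
  proof -
    consider "k \<le> i \<or> j' < k" | "i < k" "k \<le> i'" | "i' < k" "k \<le> j" | "j < k" "k \<le> j'"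
      by linarith
    then show ?thesis
    proof cases
      case 2
      then show ?thesis using order k d0 d1 e0 cut_le[of k i']
        by (auto simp: w_def shift_cuts_def)
    next
      case 3
      then show ?thesis using order k e0 ee cut_le[of "Suc i'" k] cut_le[of k j]
        by (auto simp: w_def shift_cuts_def e_def e'_def max_def split: if_splits)
    next
      case 4
      then show ?thesis using order k d0 d1 e0 cut_le[of "Suc j" k]
        by (auto simp: w_def shift_cuts_def)
    qed (use order in \<open>auto simp: w_def shift_cuts_def\<close>)
  qed
  have vols: "color_volume M c w a = color_volume M c v a" if "a \<in> {1..n}" for a
    unfolding w_def using that order same vol_shift[of i j] vol_shift[of i' j'] by simp
  have "w i' = w (Suc i') \<or> w j = w (Suc j)"
    using order by (auto simp: w_def shift_cuts_def d_def min_def)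
  then show False
    using no_collapse[OF steps vols cost, of i'] no_collapse[OF steps vols cost, of j] order by auto
qed

lemma repeated_colors_nested:
  assumes "i < j" "j \<le> M" "c i = c j" "i' < j'" "j' \<le> M" "c i' = c j'" "i < i'"
  shows "j' < j"
proof (rule ccontr)
  assume neg: "\<not> j' < j"
  have diff: "c i \<noteq> c i'"
    using no_color_thrice[of i i' j'] assms by auto
  show False
  proof (cases "i' < j")
    case True
    have "j \<noteq> j'" using diff assms by auto
    then show False using no_crossing[of i i' j j'] assms neg True by auto
  next
    case False
    with diff assms have "j < i'" by (metis linorder_neqE_nat)
    then show False
      using repeated_ends_right[of i j] repeated_starts_left[of i' j'] cut_le[of "Suc j" i'] assms
      by auto
  qed
qed

text \<open>
  Every colour occurs at most twice, so the left member of a pair determines the right one, and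
  ordering the pairs by their left members lists them from the outside inwards. The list starts with
  the two outer rays.
\<close>

lemma repeated_pairs_chain:
  assumes "0 < M"
  obtains m :: nat and p q :: "nat \<Rightarrow> nat" where "1 \<le> m" "p 1 = 0" "q 1 = M"
    "\<forall>t\<in>{1..m}. p t < q t \<and> q t \<le> M \<and> c (p t) = c (q t)"
    "\<forall>s t. 1 \<le> s \<and> s < t \<and> t \<le> m \<longrightarrow> p s < p t \<and> q t < q s"
    "\<forall>i j. i < j \<and> j \<le> M \<and> c i = c j \<longrightarrow> (\<exists>t\<in>{1..m}. i = p t \<and> j = q t)"
proof -
  define I where "I = {i. \<exists>j. i < j \<and> j \<le> M \<and> c i = c j}"
  have "I \<subseteq> {..M}" by (auto simp: I_def)
  then have fin: "finite I" using finite_subset by blast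
  obtain p where p: "strict_mono_on {1..card I} p" "I = p ` {1..card I}"
    using finite_linorder_enumeration[OF fin] .
  define q where "q t = (SOME j. p t < j \<and> j \<le> M \<and> c (p t) = c j)" for t
  have q: "p t < q t \<and> q t \<le> M \<and> c (p t) = c (q t)" if "t \<in> {1..card I}" for t
  proof -
    have "p t \<in> I" using p that by auto
    then show ?thesis unfolding q_def I_def by (auto intro: someI2_ex)
  qed
  have all: "\<exists>t\<in>{1..card I}. i = p t \<and> j = q t" if "i < j" "j \<le> M" "c i = c j" for i j
  proof -
    have "i \<in> I" using that by (auto simp: I_def)
    then obtain t where t: "t \<in> {1..card I}" "i = p t" using p(2) by blast
    have "j = q t"
    proof (rule ccontr)
      assume "j \<noteq> q t"
      then show False
        using no_color_thrice[of i j "q t"] no_color_thrice[of i "q t" j] q[OF t(1)] t that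
        by (cases "j < q t") auto
    qed
    with t show ?thesis by auto
  qed
  have nested: "p s < p t \<and> q t < q s" if "1 \<le> s" "s < t" "t \<le> card I" for s t
  proof -
    have "p s < p t" using p(1) that by (auto simp: strict_mono_on_def)
    then show ?thesis using repeated_colors_nested[of "p s" "q s" "p t" "q t"] q[of s] q[of t] that
      by auto
  qed
  obtain t where t: "t \<in> {1..card I}" "0 = p t" "M = q t"
    using all[of 0 M] assms exterior by auto
  have "t = 1" using nested[of 1 t] t by (cases "t = 1") auto
  with t have "p 1 = 0" "q 1 = M" "1 \<le> card I" by auto
  then show thesis
    by (intro that[of "card I" p q] ballI allI impI) (use q nested all in blast)+
qed

text \<open>
  Here \<open>d\<close> may have either sign: as long as \<open>\<bar>d\<bar>\<close> is below every cell length, the translated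
  family stays increasing and competes with \<open>v\<close>, while the costs outside \<open>K\<close> cancel.
\<close>

lemma rigid_shift:
  assumes K: "K \<subseteq> {1..M}"
    and vols: "\<And>d a. a \<in> {1..n} \<Longrightarrow>
      color_volume M c (\<lambda>k. if k \<in> K then v k + d else v k) a = color_volume M c v a"
  shows "\<exists>\<eta>>0. \<forall>d. \<bar>d\<bar> < \<eta> \<longrightarrow> (\<Sum>k\<in>K. g (v k)) \<le> (\<Sum>k\<in>K. g (v k + d))"
proof -
  define \<eta> where "\<eta> = Min (insert 1 ((\<lambda>k. v (Suc k) - v k) ` {1..<M}))"
  have "\<eta> > 0" unfolding \<eta>_def using cut_less by auto
  moreover have "(\<Sum>k\<in>K. g (v k)) \<le> (\<Sum>k\<in>K. g (v k + d))" if d: "\<bar>d\<bar> < \<eta>" for d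
  proof -
    define w where "w = (\<lambda>k. if k \<in> K then v k + d else v k)"
    have gap: "\<bar>d\<bar> < v (Suc k) - v k" if "1 \<le> k" "k < M" for k
      using d that unfolding \<eta>_def by auto
    have "(\<Sum>k\<in>{1..M}. g (v k)) \<le> (\<Sum>y\<in>w ` {1..M}. g y)"
    proof (intro minimal mono_on_atLeastAtMost_nat)
      show "w k \<le> w (Suc k)" if "1 \<le> k" "k < M" for k
        using gap[OF that] by (auto simp: w_def)
    qed (use vols[of _ d] in \<open>simp add: w_def\<close>)
    also have "\<dots> \<le> (\<Sum>k\<in>{1..M}. g (w k))"
      using sum_image_le[of "{1..M}" g w] cost_pos by (simp add: less_imp_le comp_def)
    finally have "(\<Sum>k\<in>K. g (v k)) + (\<Sum>k\<in>{1..M} - K. g (v k))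
      \<le> (\<Sum>k\<in>K. g (w k)) + (\<Sum>k\<in>{1..M} - K. g (w k))"
      using K by (simp add: sum.subset_diff add.commute)
    then show ?thesis by (simp add: w_def)
  qed
  ultimately show ?thesis by blast
qed

text \<open>
  Layer \<open>K t\<close> consists of the cuts enclosed by the pair \<open>(p t, q t)\<close> but not by the next pair. Its
  indicator is a difference of two shifts along pairs, so translating a single layer preserves all
  volumes. A pair has another cell between its members because adjacent colours differ, which is why
  every layer has at least two cuts.
\<close>

lemma layers:
  assumes "0 < M"
  obtains m :: nat and p q :: "nat \<Rightarrow> nat" and K :: "nat \<Rightarrow> nat set" where "1 \<le> m"
    "\<forall>t\<in>{1..m}. Suc (p t) < q t \<and> q t \<le> M"
    "\<forall>t\<in>{1..m}. Suc (p t) \<in> K t \<and> q t \<in> K t \<and> K t \<subseteq> {Suc (p t)..q t}"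
    "\<forall>s\<in>{1..m}. \<forall>t\<in>{1..m}. s \<noteq> t \<longrightarrow> K s \<inter> K t = {}"
    "(\<Union>t\<in>{1..m}. K t) = {1..M}"
    "\<forall>t\<in>{1..<m}. p t < p (Suc t) \<and> q (Suc t) < q t \<and>
       K t \<inter> {Suc (p (Suc t))..q (Suc t)} = {}"
    "\<forall>t\<in>{2..m}. 1 \<le> p t \<and> q t < M \<and> c (p t) \<noteq> 0 \<and> c (p t) = c (q t)"
    "\<forall>i j. 1 \<le> i \<and> i < j \<and> j \<le> M \<and> c i = c j \<longrightarrow>
       (\<exists>t\<in>{2..m}. i = p t \<and> j = q t)"
    "\<forall>t\<in>{1..m}. \<exists>\<eta>>0. \<forall>d. \<bar>d\<bar> < \<eta> \<longrightarrow>
       (\<Sum>k\<in>K t. g (v k)) \<le> (\<Sum>k\<in>K t. g (v k + d))"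
proof -
  obtain m :: nat and p q :: "nat \<Rightarrow> nat" where m: "1 \<le> m" and ends: "p 1 = 0" "q 1 = M"
    and pqs: "\<forall>t\<in>{1..m}. p t < q t \<and> q t \<le> M \<and> c (p t) = c (q t)"
    and nests: "\<forall>s t. 1 \<le> s \<and> s < t \<and> t \<le> m \<longrightarrow> p s < p t \<and> q t < q s"
    and all: "\<forall>i j. i < j \<and> j \<le> M \<and> c i = c j \<longrightarrow> (\<exists>t\<in>{1..m}. i = p t \<and> j = q t)"
    using repeated_pairs_chain[OF assms] .
  have pq: "p t < q t \<and> q t \<le> M \<and> c (p t) = c (q t)" if "t \<in> {1..m}" for t
    using pqs that by blast
  have nest: "p s < p t \<and> q t < q s" if "1 \<le> s" "s < t" "t \<le> m" for s t
    using nests that by blast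
  define D where "D t = (if t \<in> {1..m} then {p t<..q t} else {})" for t
  define K where "K t = D t - D (Suc t)" for t
  have gap: "Suc (p t) < q t" if "t \<in> {1..m}" for t
    using pq[OF that] alternating[of "p t"] by (cases "q t = Suc (p t)") auto
  have DSuc: "D (Suc t) \<subseteq> {Suc (p t)<..<q t}" if "t \<in> {1..m}" for t
    using nest[of t "Suc t"] that by (auto simp: D_def)
  have Danti: "D t \<subseteq> D s" if "1 \<le> s" "s \<le> t" for s t
  proof (cases "s = t \<or> m < t")
    case False
    then show ?thesis using nest[of s t] that by (auto simp: D_def)
  qed (auto simp: D_def)
  have Kends: "Suc (p t) \<in> K t \<and> q t \<in> K t \<and> K t \<subseteq> {Suc (p t)..q t}" if "t \<in> {1..m}" for t
    using DSuc[OF that] gap[OF that] that by (auto simp: K_def D_def)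
  have Ksub: "K t \<subseteq> {1..M}" if "t \<in> {1..m}" for t
    using pq[OF that] Kends[OF that] by fastforce
  have disj: "K s \<inter> K t = {}" if "s \<in> {1..m}" "t \<in> {1..m}" "s \<noteq> t" for s t
  proof (cases "s < t")
    case True
    then show ?thesis using Danti[of "Suc s" t] by (auto simp: K_def)
  next
    case False
    then show ?thesis using Danti[of "Suc t" s] that by (auto simp: K_def)
  qed
  have cover: "(\<Union>t\<in>{1..m}. K t) = {1..M}"
  proof
    show "{1..M} \<subseteq> (\<Union>t\<in>{1..m}. K t)"
    proof
      fix k assume k: "k \<in> {1..M}"
      define T where "T = {t \<in> {1..m}. k \<in> D t}"
      have finT: "finite T" by (simp add: T_def)
      have "1 \<in> T" using k m ends by (auto simp: T_def D_def)
      then have T: "Max T \<in> T" using Max_in[OF finT] by blast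
      have "k \<notin> D (Suc (Max T))"
      proof
        assume k: "k \<in> D (Suc (Max T))"
        then have "Suc (Max T) \<in> {1..m}" unfolding D_def by (meson empty_iff)
        with k have "Suc (Max T) \<in> T" by (simp add: T_def)
        then have "Suc (Max T) \<le> Max T" by (rule Max_ge[OF finT])
        then show False by simp
      qed
      with T show "k \<in> (\<Union>t\<in>{1..m}. K t)" by (auto simp: K_def T_def)
    qed
  qed (use Ksub in blast)
  have inner: "1 \<le> p t \<and> q t < M \<and> c (p t) \<noteq> 0 \<and> c (p t) = c (q t)" if t: "t \<in> {2..m}" for t
  proof -
    have pt: "0 < p t" "q t < M" using nest[of 1 t] ends t by auto
    then have "c (p t) \<noteq> 0"
      using no_color_thrice[of 0 "p t" "q t"] pq[of t] exterior t by auto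
    with pt pq[of t] t show ?thesis by auto
  qed
  have rep: "\<exists>t\<in>{2..m}. i = p t \<and> j = q t" if "1 \<le> i" "i < j" "j \<le> M" "c i = c j" for i j
  proof -
    have "\<exists>t\<in>{1..m}. i = p t \<and> j = q t"
      by (rule all[rule_format]) (use that in simp)
    then obtain t where "t \<in> {1..m}" "i = p t" "j = q t" by metis
    then show ?thesis using ends that by (cases "t = 1") auto
  qed
  have rigid: "\<exists>\<eta>>0. \<forall>d. \<bar>d\<bar> < \<eta> \<longrightarrow> (\<Sum>k\<in>K t. g (v k)) \<le> (\<Sum>k\<in>K t. g (v k + d))"
    if t: "t \<in> {1..m}" for t
  proof (rule rigid_shift[OF Ksub[OF t]])
    fix d a assume a: "a \<in> {1..n}"
    show "color_volume M c (\<lambda>k. if k \<in> K t then v k + d else v k) a = color_volume M c v a"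
    proof (cases "t = m")
      case True
      then have "(\<lambda>k. if k \<in> K t then v k + d else v k) = shift_cuts (p t) (q t) d v"
        using t by (auto simp: K_def D_def shift_cuts_def)
      then show ?thesis using vol_shift pq[OF t] a by simp
    next
      case False
      then have t': "Suc t \<in> {1..m}" using t by auto
      have "(\<lambda>k. if k \<in> K t then v k + d else v k) =
          shift_cuts (p t) (q t) d (shift_cuts (p (Suc t)) (q (Suc t)) (- d) v)"
        using t t' nest[of t "Suc t"] by (auto simp: K_def D_def shift_cuts_def)
      then show ?thesis using vol_shift pq[OF t] pq[OF t'] a by simp
    qed
  qed
  have between: "p t < p (Suc t) \<and> q (Suc t) < q t \<and> K t \<inter> {Suc (p (Suc t))..q (Suc t)} = {}"
    if t: "t \<in> {1..<m}" for t
    using nest[of t "Suc t"] t by (auto simp: K_def D_def)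
  show thesis
    using gap pq Kends disj cover inner rep rigid between
    by (intro that[OF m, of p q K] ballI allI impI) simp_all
qed

end

section \<open>The volume coordinate\<close>

text \<open>
  Monotonicity on both sides makes \<open>f 0\<close> a positive lower bound of \<open>f\<close>, so the antiderivative is
  unbounded in both directions and therefore a bijection of the line.
\<close>

lemma volume_coordinate:
  fixes f :: "real \<Rightarrow> real"
  assumes pos: "is_density f" and cont: "continuous_on UNIV f"
    and dec: "antimono_on {..0} f" and inc: "mono_on {0..} f"
  obtains F :: "real \<Rightarrow> real" where "strict_mono F" "bij F" "F 0 = 0" "continuous_on UNIV F"
    "\<And>a b. a \<le> b \<Longrightarrow> (f has_integral (F b - F a)) {a..b}"
proof -
  have "\<exists>F. \<forall>x::real. - \<infinity> < ereal x \<longrightarrow> ereal x < \<infinity> \<longrightarrow> (F has_vector_derivative f x) (at x)"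
    by (rule einterval_antiderivative) (use cont in \<open>auto simp: continuous_on_eq_continuous_at\<close>)
  then obtain H where H: "\<And>x::real. (H has_vector_derivative f x) (at x)" by auto
  define F where "F x = H x - H 0" for x
  have F: "(F has_vector_derivative f x) (at x)" for x
    unfolding F_def using H[of x] by (auto intro!: derivative_eq_intros)
  then have DF: "(F has_real_derivative f x) (at x)" for x
    by (simp add: has_real_derivative_iff_has_vector_derivative)
  have int: "(f has_integral (F b - F a)) {a..b}" if "a \<le> b" for a b
    by (rule fundamental_theorem_of_calculus[OF that]) (use F has_vector_derivative_at_within in blast)
  have sm: "strict_mono F"
  proof (rule strict_monoI)
    fix x y :: real assume "x < y"
    then show "F x < F y"
      using DERIV_pos_imp_increasing[of x y F] DF pos unfolding is_density_def by blast
  qed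
  have contF: "continuous_on UNIV F"
    using DF DERIV_isCont by (auto simp: continuous_on_eq_continuous_at)
  have ge: "f 0 \<le> f x" for x
    using dec inc by (cases "x \<le> 0") (auto simp: monotone_on_def)
  have growth: "f 0 * (b - a) \<le> F b - F a" if "a \<le> b" for a b
  proof -
    have "((\<lambda>_. f 0) has_integral (b - a) *\<^sub>R f 0) {a..b}"
      using that has_integral_const_real[of "f 0" a b] by simp
    from has_integral_le[OF this int[OF that]] ge show ?thesis by (simp add: mult.commute)
  qed
  have "surj F"
  proof (rule surjI)
    fix y :: real
    have f0: "f 0 > 0" using pos by (auto simp: is_density_def)
    define b where "b = \<bar>y\<bar> / f 0"
    have b: "0 \<le> b" "f 0 * b = \<bar>y\<bar>" using f0 by (auto simp: b_def)
    have "F (- b) \<le> y" "y \<le> F b"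
      using growth[of "- b" 0] growth[of 0 b] b by (auto simp: F_def)
    then obtain x where "F x = y"
      using IVT'[of F "- b" y b] b contF continuous_on_subset[of UNIV F] by auto
    then show "F (SOME x. F x = y) = y" by (rule someI)
  qed
  then have "bij F" using sm strict_mono_imp_inj_on by (auto simp: bij_def)
  with sm contF int that show thesis by (auto simp: F_def)
qed

section \<open>Bubbles as coloured cells\<close>

text \<open>
  Collapsed cells are left out: the intervals of a bubble must have positive length, but the cuts of a
  competitor may coincide.
\<close>

definition cells :: "nat \<Rightarrow> (nat \<Rightarrow> nat) \<Rightarrow> (nat \<Rightarrow> real) \<Rightarrow> nat \<Rightarrow> real set" where
  "cells M c z a = (\<Union>k\<in>{k. k \<in> {1..<M} \<and> c k = a \<and> z k < z (Suc k)}. {z k..z (Suc k)})"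

lemma overlapping_cells:
  fixes z :: "nat \<Rightarrow> real"
  assumes "mono_on {1..M} z" "k \<in> {1..<M}" "l \<in> {1..<M}" "k \<noteq> l"
  shows "{z k..z (Suc k)} \<inter> {z l..z (Suc l)} \<subseteq> z ` {1..M}"
proof -
  have *: "{z k..z (Suc k)} \<inter> {z l..z (Suc l)} \<subseteq> {z l}"
    if "k < l" "k \<in> {1..<M}" "l \<in> {1..<M}" for k l
  proof -
    have "z (Suc k) \<le> z l" using that assms(1) by (auto simp: mono_on_def)
    then show ?thesis by auto
  qed
  show ?thesis
  proof (cases "k < l")
    case True
    then show ?thesis using *[of k l] assms by auto
  next
    case False
    then show ?thesis using *[of l k] assms by (auto simp: Int_commute)
  qed
qed

lemma volume_cells:
  assumes F: "\<And>a b. a \<le> b \<Longrightarrow> (f has_integral (F b - F a)) {a..b}"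
    and z: "mono_on {1..M} z"
  shows "volume f (cells M c z a) = color_volume M c (\<lambda>k. F (z k)) a"
proof -
  let ?I = "{k. k \<in> {1..<M} \<and> c k = a \<and> z k < z (Suc k)}"
  have "(f has_integral (\<Sum>k\<in>?I. F (z (Suc k)) - F (z k))) (cells M c z a)"
    unfolding cells_def
  proof (rule has_integral_UN)
    show "pairwise (\<lambda>k l. negligible ({z k..z (Suc k)} \<inter> {z l..z (Suc l)})) ?I"
    proof (rule pairwiseI)
      fix k l assume "k \<in> ?I" "l \<in> ?I" "k \<noteq> l"
      then have "{z k..z (Suc k)} \<inter> {z l..z (Suc l)} \<subseteq> z ` {1..M}"
        using overlapping_cells[OF z] by auto
      then show "negligible ({z k..z (Suc k)} \<inter> {z l..z (Suc l)})"
        by (meson finite_atLeastAtMost finite_imageI negligible_finite negligible_subset)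
    qed
  qed (auto intro: F)
  then have "volume f (cells M c z a) = (\<Sum>k\<in>?I. F (z (Suc k)) - F (z k))"
    unfolding volume_def by (rule integral_unique)
  also have "\<dots> = color_volume M c (\<lambda>k. F (z k)) a"
    unfolding color_volume_def
  proof (rule sum.mono_neutral_left)
    show "\<forall>k\<in>{k. k \<in> {1..<M} \<and> c k = a} - ?I. F (z (Suc k)) - F (z k) = 0"
    proof
      fix k assume k: "k \<in> {k. k \<in> {1..<M} \<and> c k = a} - ?I"
      then have "z k \<le> z (Suc k)" using z by (auto simp: mono_on_def)
      with k show "F (z (Suc k)) - F (z k) = 0" by auto
    qed
  qed auto
  finally show ?thesis .
qed

lemma finite_interval_union_cells: "finite_interval_union (cells M c z a)"
  unfolding finite_interval_union_def cells_def
  by (rule exI[of _ "(\<lambda>k. {z k..z (Suc k)}) ` {k. k \<in> {1..<M} \<and> c k = a \<and> z k < z (Suc k)}"]) auto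

lemma frontier_cells_subset: "frontier (cells M c z a) \<subseteq> z ` {1..M}"
proof -
  have "frontier (cells M c z a) \<subseteq>
      (\<Union>C\<in>(\<lambda>k. {z k..z (Suc k)}) ` {k. k \<in> {1..<M} \<and> c k = a \<and> z k < z (Suc k)}. frontier C)"
    unfolding cells_def by (rule frontier_Union_subset) auto
  also have "\<dots> \<subseteq> z ` {1..M}"
    by (auto simp: frontier_def)
  finally show ?thesis .
qed

lemma closed_cells: "closed (cells M c z a)"
  unfolding cells_def by auto

lemma is_bubble_cells:
  assumes z: "mono_on {1..M} z"
  shows "is_bubble n (cells M c z)"
proof -
  have "interior (cells M c z a) \<inter> interior (cells M c z b) = {}" if "a \<noteq> b" for a b
  proof -
    have "cells M c z a \<inter> cells M c z b \<subseteq> z ` {1..M}"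
      unfolding cells_def using overlapping_cells[OF z] that by fast
    then have "finite (cells M c z a \<inter> cells M c z b)"
      using finite_subset by blast
    then show ?thesis
      using interior_Int empty_interior_finite by metis
  qed
  then show ?thesis
    unfolding is_bubble_def by (simp add: finite_interval_union_cells)
qed

lemma locate_cell:
  fixes x :: "nat \<Rightarrow> real"
  assumes "x 1 \<le> p" "p < x M" "1 \<le> M"
  obtains k where "k \<in> {1..<M}" "x k \<le> p" "p < x (Suc k)"
proof -
  have "\<exists>k\<in>{1..<M}. x k \<le> p \<and> p < x (Suc k)"
    using \<open>1 \<le> M\<close> assms(2)
  proof (induction M rule: dec_induct)
    case base
    then show ?case using assms by simp
  next
    case (step M)
    show ?case
    proof (cases "p < x M")
      case True
      with step.IH obtain k where "k \<in> {1..<M}" "x k \<le> p" "p < x (Suc k)" by blast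
      then show ?thesis by (intro bexI[of _ k]) auto
    next
      case False
      with step show ?thesis by (intro bexI[of _ M]) auto
    qed
  qed
  with that show thesis by blast
qed

lemma finite_frontier_interval_union:
  assumes "finite_interval_union S" shows "finite (frontier S)" "closed S" "bounded S"
proof -
  obtain \<I> where I: "finite \<I>" "\<And>C. C \<in> \<I> \<Longrightarrow> \<exists>a b. a < b \<and> C = {a..b}" "S = \<Union>\<I>"
    using assms unfolding finite_interval_union_def by blast
  have fr: "finite (frontier C)" if C: "C \<in> \<I>" for C :: "real set"
  proof -
    obtain a b where "C = {a..b}" using I(2)[OF C] by auto
    then have "frontier C \<subseteq> {a, b}" by (auto simp: frontier_def)
    then show ?thesis using finite_subset by blast
  qed
  then have "finite (\<Union>C\<in>\<I>. frontier C)" using I by auto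
  then show "finite (frontier S)"
    using frontier_Union_subset[OF I(1)] I(3) finite_subset by blast
  have *: "closed C \<and> bounded C" if C: "C \<in> \<I>" for C
    using I(2)[OF C] by auto
  then show "closed S" "bounded S"
    using I by auto
qed

lemma interval_union_islimpt:
  assumes "finite_interval_union S" "p \<in> S"
  shows "p islimpt S"
proof -
  obtain \<I> where I: "\<forall>C\<in>\<I>. \<exists>a b. a < b \<and> C = {a..b}" "S = \<Union>\<I>"
    using assms(1) unfolding finite_interval_union_def by metis
  obtain C where C: "C \<in> \<I>" "p \<in> C" using assms(2) I(2) by auto
  obtain s t where st: "s < t" "C = {s..t}" using I(1) C(1) by metis
  have "p islimpt {s..t}"
    by (rule connected_imp_perfect) (use st C in auto)
  then show ?thesis by (rule islimpt_subset) (use st C I in auto)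
qed

text \<open>
  An open cell between consecutive boundary points is connected and contains no frontier point, so it
  lies inside or outside each bubble; interiors being disjoint, it lies in at most one. This recovers
  every bubble up to finitely many points, and these are limits of the remaining ones because the
  intervals of a bubble are nondegenerate.
\<close>

lemma bubble_as_cells:
  assumes bubble: "is_bubble n E"
  obtains M :: nat and x c where "strict_mono_on {1..M} x" "boundary_points n E = x ` {1..M}"
    "\<And>a. a \<in> {1..n} \<Longrightarrow> E a = cells M c x a"
    "c 0 = 0" "c M = 0" "\<And>k. c k \<le> n"
proof -
  let ?P = "boundary_points n E"
  have fiu: "finite_interval_union (E a)" if "a \<in> {1..n}" for a
    using bubble that by (auto simp: is_bubble_def)
  have "finite ?P"
    unfolding boundary_points_def using fiu finite_frontier_interval_union by auto
  from finite_linorder_enumeration[OF this] obtain x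
    where x: "strict_mono_on {1..card ?P} x" "?P = x ` {1..card ?P}" .
  define M where "M = card ?P"
  define c where "c k = (if k \<in> {1..<M} \<and> (\<exists>a\<in>{1..n}. {x k<..<x (Suc k)} \<subseteq> E a)
      then SOME a. a \<in> {1..n} \<and> {x k<..<x (Suc k)} \<subseteq> E a else 0)" for k
  have c1: "c k \<in> {1..n} \<and> {x k<..<x (Suc k)} \<subseteq> E (c k)"
    if "k \<in> {1..<M}" "a \<in> {1..n}" "{x k<..<x (Suc k)} \<subseteq> E a" for k a
  proof -
    have "c k = (SOME a. a \<in> {1..n} \<and> {x k<..<x (Suc k)} \<subseteq> E a)"
      using that by (auto simp: c_def)
    then show ?thesis
      using that someI[of "\<lambda>a. a \<in> {1..n} \<and> {x k<..<x (Suc k)} \<subseteq> E a" a] by metis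
  qed
  have c2: "c k = 0 \<or> k \<in> {1..<M} \<and> c k \<in> {1..n} \<and> {x k<..<x (Suc k)} \<subseteq> E (c k)" for k
  proof (cases "k \<in> {1..<M} \<and> (\<exists>a\<in>{1..n}. {x k<..<x (Suc k)} \<subseteq> E a)")
    case True
    then show ?thesis using c1 by blast
  next
    case False
    then have "c k = 0" unfolding c_def by (rule if_not_P)
    then show ?thesis ..
  qed
  have lt: "x k < x (Suc k)" if "k \<in> {1..<M}" for k
    using x(1) that by (auto simp: M_def strict_mono_on_def)
  have fr: "frontier (E a) \<subseteq> x ` {1..M}" if "a \<in> {1..n}" for a
    using x(2) that unfolding M_def boundary_points_def by blast
  have "E a = cells M c x a" if a: "a \<in> {1..n}" for a
  proof
    show "cells M c x a \<subseteq> E a"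
    proof -
      have "{x k..x (Suc k)} \<subseteq> E a" if k: "k \<in> {1..<M}" "c k = a" for k
      proof -
        have "{x k<..<x (Suc k)} \<subseteq> E a" using c2[of k] k a by auto
        then have "closure {x k<..<x (Suc k)} \<subseteq> E a"
          using finite_frontier_interval_union(2)[OF fiu[OF a]] by (rule closure_minimal)
        then show ?thesis using lt[OF k(1)] by simp
      qed
      then show ?thesis unfolding cells_def by auto
    qed
    show "E a \<subseteq> cells M c x a"
    proof
      have sub: "E a - x ` {1..M} \<subseteq> cells M c x a"
      proof
        fix p assume p: "p \<in> E a - x ` {1..M}"
        obtain B where B: "\<And>y. y \<in> E a \<Longrightarrow> \<bar>y\<bar> \<le> B"
          using finite_frontier_interval_union(3)[OF fiu[OF a]] by (auto simp: bounded_real)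
        \<comment> \<open>Boundedness yields points outside \<open>E a\<close> on both sides of \<open>p\<close>, hence boundary points.\<close>
        have out: "- \<bar>B\<bar> - \<bar>p\<bar> - 1 \<notin> E a" "\<bar>B\<bar> + \<bar>p\<bar> + 1 \<notin> E a"
          using B[of "- \<bar>B\<bar> - \<bar>p\<bar> - 1"] B[of "\<bar>B\<bar> + \<bar>p\<bar> + 1"] by linarith+
        have "p \<in> {..p} \<inter> E a" "- \<bar>B\<bar> - \<bar>p\<bar> - 1 \<in> {..p} - E a"
          using p out by auto
        then have "{..p} \<inter> frontier (E a) \<noteq> {}"
          using connected_Int_frontier[OF connected_Iic] by (metis empty_iff)
        then obtain k1 where k1: "k1 \<in> {1..M}" "x k1 \<le> p" using fr[OF a] by blast
        have "p \<in> {p..} \<inter> E a" "\<bar>B\<bar> + \<bar>p\<bar> + 1 \<in> {p..} - E a"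
          using p out by auto
        then have "{p..} \<inter> frontier (E a) \<noteq> {}"
          using connected_Int_frontier[OF connected_Ici] by (metis empty_iff)
        then obtain k2 where k2: "k2 \<in> {1..M}" "p \<le> x k2" using fr[OF a] by blast
        have "x 1 \<le> p" using k1 x(1) strict_mono_on_leD[of "{1..M}" x 1 k1] by (auto simp: M_def)
        moreover have "p \<le> x M" using k2 x(1) strict_mono_on_leD[of "{1..M}" x k2 M] by (auto simp: M_def)
        then have "p < x M" using p k1 by (cases "p = x M") auto
        ultimately obtain k where k: "k \<in> {1..<M}" "x k \<le> p" "p < x (Suc k)"
          using locate_cell[of x p M] k1 by auto
        then have pk: "p \<in> {x k<..<x (Suc k)}" using p by (cases "p = x k") auto
        have "{x k<..<x (Suc k)} \<inter> frontier (E a) = {}"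
        proof -
          have "x l \<notin> {x k<..<x (Suc k)}" if "l \<in> {1..M}" for l
            using x(1) k that strict_mono_on_leD[of "{1..M}" x l k]
            strict_mono_on_leD[of "{1..M}" x "Suc k" l]
            by (cases "l \<le> k") (auto simp: M_def)
          then show ?thesis using fr[OF a] by blast
        qed
        moreover have "{x k<..<x (Suc k)} \<inter> E a \<noteq> {}" using pk p by blast
        ultimately have sub: "{x k<..<x (Suc k)} \<subseteq> E a"
          using connected_Int_frontier[of "{x k<..<x (Suc k)}" "E a"]
          by (metis Diff_eq_empty_iff connected_Ioo)
        have ck: "c k \<in> {1..n}" "{x k<..<x (Suc k)} \<subseteq> E (c k)" using c1[OF k(1) a sub] by auto
        have "p \<in> interior (E a) \<inter> interior (E (c k))"
          using pk interior_maximal[OF sub open_greaterThanLessThan]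
            interior_maximal[OF ck(2) open_greaterThanLessThan] by blast
        then have "c k = a" using bubble a ck(1) unfolding is_bubble_def by (metis empty_iff)
        then show "p \<in> cells M c x a" unfolding cells_def using k lt[OF k(1)] pk by auto
      qed
      fix p assume "p \<in> E a"
      then have "p islimpt E a" by (rule interval_union_islimpt[OF fiu[OF a]])
      moreover have "E a = (E a \<inter> x ` {1..M}) \<union> (E a - x ` {1..M})" by auto
      ultimately have "p islimpt (E a - x ` {1..M})"
        using islimpt_Un_finite[of "E a \<inter> x ` {1..M}" p "E a - x ` {1..M}"]
        by (metis finite_Int finite_atLeastAtMost finite_imageI)
      then have "p islimpt cells M c x a" using sub by (rule islimpt_subset)
      then show "p \<in> cells M c x a" using closed_cells[of M c x a] by (simp add: closed_limpt)
    qed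
  qed
  moreover have "c 0 = 0" "c M = 0" by (auto simp: c_def)
  moreover have "c k \<le> n" for k using c2[of k] by auto
  ultimately show thesis
    using that[OF x(1)[folded M_def] x(2)[folded M_def]] by blast
qed

text \<open>
  A cut between two cells of the same bubble is interior to that bubble and belongs to no other one,
  and a cut between two gaps belongs to no bubble; neither is a boundary point. For \<open>k = 0\<close> and \<open>Suc k = M\<close> the lemma says that the outermost
  bounded cells are not gaps.
\<close>

lemma adjacent_colors_differ:
  assumes x: "strict_mono_on {1..M} x" and bd: "boundary_points n E = x ` {1..M}"
    and E: "\<And>a. a \<in> {1..n} \<Longrightarrow> E a = cells M c x a"
    and c: "c 0 = 0" "c M = 0" and k: "k < M"
  shows "c k \<noteq> c (Suc k)"
proof
  assume same: "c k = c (Suc k)"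
  have le: "x i \<le> x j" if "1 \<le> i" "i \<le> j" "j \<le> M" for i j
    using strict_mono_on_leD[OF x] that by auto
  have less: "x i < x j" if "1 \<le> i" "i < j" "j \<le> M" for i j
    using x that by (auto simp: strict_mono_on_def)
  have "x (Suc k) \<in> boundary_points n E" using bd k by auto
  then obtain b where b: "b \<in> {1..n}" "x (Suc k) \<in> frontier (E b)"
    by (auto simp: boundary_points_def)
  then have "x (Suc k) \<in> cells M c x b"
    using E[OF b(1)] frontier_subset_closed[OF closed_cells, of M c x b] by auto
  then obtain l where l: "l \<in> {1..<M}" "c l = b" "x l \<le> x (Suc k)" "x (Suc k) \<le> x (Suc l)"
    by (auto simp: cells_def)
  have "l = k \<or> l = Suc k"
    using l less[of "Suc k" l] less[of "Suc l" "Suc k"] k by fastforce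
  then have ck: "c k = b" "c (Suc k) = b" using same l by auto
  then have kk: "1 \<le> k" "Suc k < M"
    using b c k by (auto simp: Suc_le_eq intro!: Nat.gr0I le_neq_implies_less)
  have "{x k..x (Suc k)} \<union> {x (Suc k)..x (Suc (Suc k))} \<subseteq> E b"
    using E b ck kk less unfolding cells_def by auto
  moreover have "{x k<..<x (Suc (Suc k))} \<subseteq> {x k..x (Suc k)} \<union> {x (Suc k)..x (Suc (Suc k))}"
    by auto
  ultimately have "{x k<..<x (Suc (Suc k))} \<subseteq> E b" by blast
  then have "x (Suc k) \<in> interior (E b)"
    using interior_maximal[of "{x k<..<x (Suc (Suc k))}" "E b"]
      less[of k "Suc k"] less[of "Suc k" "Suc (Suc k)"] kk by auto
  with b show False by (auto simp: frontier_def)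
qed

section \<open>Chains of contiguous intervals\<close>

lemma chain_bubble:
  fixes y :: "nat \<Rightarrow> real"
  assumes y: "strict_mono_on {1..Suc k} y" and k: "1 \<le> k"
  defines "B \<equiv> \<lambda>a. {y a..y (Suc a)}"
  shows "is_bubble k B" and "boundary_points k B = y ` {1..Suc k}"
    and "region k B = {y 1..y (Suc k)}" and "bubble_components k B = B ` {1..k}"
    and "contiguous k B" and "\<And>a. a \<in> {1..k} \<Longrightarrow> components (B a) = {B a}"
proof -
  have less: "y i < y j" if "1 \<le> i" "i < j" "j \<le> Suc k" for i j
    using y that by (auto simp: strict_mono_on_def)
  have le: "y i \<le> y j" if "1 \<le> i" "i \<le> j" "j \<le> Suc k" for i j
    using strict_mono_on_leD[OF y] that by auto
  show comp: "components (B a) = {B a}" if "a \<in> {1..k}" for a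
    unfolding components_eq_sing_iff using less[of a "Suc a"] that by (auto simp: B_def)
  then show bc: "bubble_components k B = B ` {1..k}"
    by (auto simp: bubble_components_def)
  have disj: "interior (B a) \<inter> interior (B b) = {}" if "a \<in> {1..k}" "b \<in> {1..k}" "a < b" for a b
    using le[of "Suc a" b] that by (auto simp: B_def)
  show "is_bubble k B"
    unfolding is_bubble_def
  proof (intro conjI ballI impI)
    fix a assume "a \<in> {1..k}"
    then show "finite_interval_union (B a)"
      unfolding finite_interval_union_def B_def using less[of a "Suc a"]
      by (intro exI[of _ "{{y a..y (Suc a)}}"]) auto
  next
    fix a b assume "a \<in> {1..k}" "b \<in> {1..k}" "a \<noteq> b"
    then show "interior (B a) \<inter> interior (B b) = {}"
      using disj[of a b] disj[of b a] by (cases "a < b") auto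
  qed
  have fr: "frontier (B a) = {y a, y (Suc a)}" if "a \<in> {1..k}" for a
    using less[of a "Suc a"] that by (auto simp: B_def frontier_def)
  show "boundary_points k B = y ` {1..Suc k}"
  proof
    show "y ` {1..Suc k} \<subseteq> boundary_points k B"
    proof
      fix z assume "z \<in> y ` {1..Suc k}"
      then obtain s where s: "s \<in> {1..Suc k}" "z = y s" by auto
      show "z \<in> boundary_points k B"
      proof (cases "s \<le> k")
        case True
        then show ?thesis using s fr[of s] by (auto simp: boundary_points_def)
      next
        case False
        then have "s = Suc k" using s by auto
        then show ?thesis using s k fr[of k] by (auto simp: boundary_points_def)
      qed
    qed
  qed (auto simp: boundary_points_def fr)
  show "region k B = {y 1..y (Suc k)}"
  proof
    show "region k B \<subseteq> {y 1..y (Suc k)}"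
    proof
      fix z assume "z \<in> region k B"
      then obtain a where "a \<in> {1..k}" "y a \<le> z" "z \<le> y (Suc a)" by (auto simp: region_def B_def)
      then show "z \<in> {y 1..y (Suc k)}" using le[of 1 a] le[of "Suc a" "Suc k"] by auto
    qed
    show "{y 1..y (Suc k)} \<subseteq> region k B"
    proof
      fix z assume z: "z \<in> {y 1..y (Suc k)}"
      show "z \<in> region k B"
      proof (cases "z = y (Suc k)")
        case True
        then show ?thesis using k le[of k "Suc k"] by (auto simp: region_def B_def)
      next
        case False
        then obtain a where "a \<in> {1..<Suc k}" "y a \<le> z" "z < y (Suc a)"
          using locate_cell[of y z "Suc k"] z by auto
        then show ?thesis by (auto simp: region_def B_def intro!: bexI[of _ a])
      qed
    qed
  qed
  have ends: "Inf (B a) = y a" "Sup (B a) = y (Suc a)" if "a \<in> {1..k}" for a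
    using less[of a "Suc a"] that by (auto simp: B_def)
  let ?Cs = "map (\<lambda>j. B (Suc j)) [0..<k]"
  have nth: "?Cs ! j = B (Suc j)" "Suc j \<in> {1..k}" if "j < length ?Cs" for j
    using that by auto
  show "contiguous k B"
    unfolding contiguous_def
  proof (intro exI[of _ ?Cs] conjI allI impI)
    have "set ?Cs = B ` Suc ` {0..<k}" by (simp add: image_image del: image_Suc_atLeastLessThan)
    also have "Suc ` {0..<k} = {1..k}" by (auto simp: image_Suc_atLeastLessThan)
    finally show "set ?Cs = bubble_components k B" using bc by simp
    show "sorted_wrt (\<lambda>C D. Inf C < Inf D) ?Cs"
      unfolding sorted_wrt_iff_nth_less
    proof (intro allI impI)
      fix i j assume ij: "i < j" "j < length ?Cs"
      then show "Inf (?Cs ! i) < Inf (?Cs ! j)"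
        using nth[of i] nth[of j] ends(1)[of "Suc i"] ends(1)[of "Suc j"] less[of "Suc i" "Suc j"] by auto
    qed
  next
    fix j assume j: "Suc j < length ?Cs"
    then show "Sup (?Cs ! j) = Inf (?Cs ! Suc j)"
      using nth[of j] nth[of "Suc j"] ends(2)[of "Suc j"] ends(1)[of "Suc (Suc j)"] by auto
  qed
qed

lemma perimeter_chain:
  fixes y :: "nat \<Rightarrow> real"
  assumes "strict_mono_on {1..Suc k} y" "1 \<le> k" "\<And>a. a \<in> {1..k} \<Longrightarrow> B a = {y a..y (Suc a)}"
  shows "perimeter f k B = (\<Sum>s\<in>{1..Suc k}. f (y s))"
proof -
  have "boundary_points k B = boundary_points k (\<lambda>a. {y a..y (Suc a)})"
    using assms(3) by (auto simp: boundary_points_def)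
  then have "perimeter f k B = (\<Sum>x\<in>y ` {1..Suc k}. f x)"
    using chain_bubble(2)[OF assms(1,2)] by (simp add: perimeter_def)
  also have "\<dots> = (\<Sum>s\<in>{1..Suc k}. f (y s))"
    using strict_mono_on_imp_inj_on[OF assms(1)] by (subst sum.reindex) (auto simp: comp_def)
  finally show ?thesis .
qed

text \<open>
  Preserving the volume of each interval of a chain forces \<open>F\<close> to change by the same amount at all its
  end points. Only rigid translations in the volume coordinate have to be compared, and their size is
  controlled by the displacement of the leftmost point alone.
\<close>

lemma chain_in_equilibrium:
  fixes y :: "nat \<Rightarrow> real"
  assumes F: "strict_mono F" "continuous_on UNIV F"
      "\<And>a b. a \<le> b \<Longrightarrow> (f has_integral (F b - F a)) {a..b}"
    and y: "strict_mono_on {1..Suc k} y" and k: "1 \<le> k" and "\<eta> > 0"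
    and rigid: "\<And>d z. \<bar>d\<bar> < \<eta> \<Longrightarrow> (\<And>s. s \<in> {1..Suc k} \<Longrightarrow> F (z s) = F (y s) + d) \<Longrightarrow>
      (\<Sum>s\<in>{1..Suc k}. f (y s)) \<le> (\<Sum>s\<in>{1..Suc k}. f (z s))"
  shows "in_equilibrium f k (\<lambda>a. {y a..y (Suc a)})"
proof -
  let ?B = "\<lambda>a. {y a..y (Suc a)}"
  have less: "y i < y j" if "1 \<le> i" "i < j" "j \<le> Suc k" for i j
    using y that by (auto simp: strict_mono_on_def)
  have Fless: "F s < F t \<longleftrightarrow> s < t" for s t
    using F(1) by (rule strict_mono_less)
  have vol: "volume f {s..t} = F t - F s" if "s \<le> t" for s t
    unfolding volume_def using F(3)[OF that] by (rule integral_unique)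
  have "isCont F (y 1)" using F(2) by (simp add: continuous_on_eq_continuous_at)
  then obtain \<epsilon> where \<epsilon>: "\<epsilon> > 0" "\<And>u. \<bar>u - y 1\<bar> < \<epsilon> \<Longrightarrow> \<bar>F u - F (y 1)\<bar> < \<eta>"
    using \<open>\<eta> > 0\<close> unfolding continuous_at_eps_delta dist_real_def by blast
  have "perimeter f k ?B \<le> perimeter f k (displace \<phi> ?B)"
    if near: "\<forall>x\<in>boundary_points k ?B. \<bar>\<phi> x - x\<bar> < \<epsilon>"
      and vols: "\<forall>a\<in>{1..k}. volume f (displace \<phi> ?B a) = volume f (?B a)" for \<phi>
  proof -
    define z where "z s = \<phi> (y s)" for s
    have disp: "displace \<phi> ?B a = {z a..z (Suc a)}" if "a \<in> {1..k}" for a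
      using chain_bubble(6)[OF y k that] less[of a "Suc a"] that by (simp add: displace_def z_def)
    have step: "F (z (Suc a)) - F (z a) = F (y (Suc a)) - F (y a)" if a: "a \<in> {1..k}" for a
    proof -
      have "y a < y (Suc a)" using less a by auto
      then have *: "volume f {z a..z (Suc a)} = F (y (Suc a)) - F (y a)" "F (y a) < F (y (Suc a))"
        using vols disp a vol by (auto simp: Fless)
      \<comment> \<open>Otherwise the displaced interval is empty and has volume \<open>0\<close>.\<close>
      then have "z a \<le> z (Suc a)" by (cases "z a \<le> z (Suc a)") (auto simp: volume_def)
      with * vol show ?thesis by simp
    qed
    define d where "d = F (z 1) - F (y 1)"
    have "y 1 \<in> boundary_points k ?B" using chain_bubble(2)[OF y k] by auto
    then have d: "\<bar>d\<bar> < \<eta>" unfolding d_def z_def using near \<epsilon>(2) by blast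
    have shift: "F (z s) = F (y s) + d" if "s \<in> {1..Suc k}" for s
    proof -
      have "1 \<le> s" "s \<le> Suc k" using that by auto
      then show ?thesis
      proof (induction s rule: dec_induct)
        case (step s)
        then show ?case
          using \<open>\<And>a. a \<in> {1..k} \<Longrightarrow> F (z (Suc a)) - F (z a) = F (y (Suc a)) - F (y a)\<close>[of s]
          by auto
      qed (simp add: d_def)
    qed
    have "strict_mono_on {1..Suc k} z"
    proof (rule strict_mono_onI)
      fix r s assume "r \<in> {1..Suc k}" "s \<in> {1..Suc k}" "r < s"
      then show "z r < z s"
        using shift[of r] shift[of s] less[of r s] Fless[of "y r" "y s"] Fless[of "z r" "z s"]
        by auto
    qed
    then have "perimeter f k (displace \<phi> ?B) = (\<Sum>s\<in>{1..Suc k}. f (z s))"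
      using perimeter_chain[of k z "displace \<phi> ?B" f] k disp by blast
    moreover have "perimeter f k ?B = (\<Sum>s\<in>{1..Suc k}. f (y s))"
      by (rule perimeter_chain[OF y k]) (rule refl)
    moreover have "(\<Sum>s\<in>{1..Suc k}. f (y s)) \<le> (\<Sum>s\<in>{1..Suc k}. f (z s))"
      by (rule rigid[OF d shift])
    ultimately show ?thesis by simp
  qed
  with \<epsilon>(1) show ?thesis
    unfolding in_equilibrium_def by (intro exI[of _ \<epsilon>] conjI allI impI)
qed

lemma chain_bubble_inside_cell:
  fixes y :: "nat \<Rightarrow> real"
  assumes y: "strict_mono_on {1..Suc k} y" and k: "1 \<le> k"
    and st: "y 1 \<le> s" "s \<le> t" "t \<le> y (Suc k)" and avoid: "{s..t} \<inter> y ` {1..Suc k} = {}"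
  shows "\<exists>C\<in>bubble_components k (\<lambda>a. {y a..y (Suc a)}). {s..t} \<subseteq> C"
proof -
  have outside: "y j \<notin> {s..t}" if "j \<in> {1..Suc k}" for j
    using avoid imageI[OF that, of y] by (meson disjoint_iff)
  have "s < y (Suc k)" using outside[of "Suc k"] st by auto
  then obtain a where a: "a \<in> {1..<Suc k}" "y a \<le> s" "s < y (Suc a)"
    using locate_cell[of y s "Suc k"] st by auto
  have "{s..t} \<subseteq> {y a..y (Suc a)}" using outside[of "Suc a"] a by auto
  moreover have "{y a..y (Suc a)} \<in> bubble_components k (\<lambda>a. {y a..y (Suc a)})"
    unfolding chain_bubble(4)[OF y k] using a by (intro imageI) auto
  ultimately show ?thesis by (rule bexI)
qed

lemma components_two_intervals:
  fixes p q r s :: real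
  assumes "p \<le> q" "q < r" "r \<le> s"
  shows "{p..q} \<in> components ({p..q} \<union> {r..s})" "{r..s} \<in> components ({p..q} \<union> {r..s})"
proof -
  let ?S = "{p..q} \<union> {r..s}"
  have no_bridge: False if "D \<subseteq> ?S" "connected D" "u \<in> D" "u \<le> q" "w \<in> D" "r \<le> w" for D u w
  proof -
    have "(q + r) / 2 \<in> D"
      using connectedD_interval[OF that(2,3,5), of "(q + r) / 2"] that assms by auto
    then show False using that(1) assms by auto
  qed
  show "{p..q} \<in> components ?S"
    unfolding in_components_maximal
  proof (intro conjI allI impI)
    fix D assume D: "D \<noteq> {} \<and> {p..q} \<subseteq> D \<and> D \<subseteq> ?S \<and> connected D"
    have "p \<in> D" using D assms by auto
    then have "\<not> r \<le> w" if "w \<in> D" for w using no_bridge[of D p w] D assms that by blast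
    moreover have "w \<in> {p..q} \<or> w \<in> {r..s}" if "w \<in> D" for w using D that by blast
    ultimately have "D \<subseteq> {p..q}" by (auto simp: subset_iff)
    with D show "D = {p..q}" by auto
  qed (use assms in auto)
  show "{r..s} \<in> components ?S"
    unfolding in_components_maximal
  proof (intro conjI allI impI)
    fix D assume D: "D \<noteq> {} \<and> {r..s} \<subseteq> D \<and> D \<subseteq> ?S \<and> connected D"
    have "r \<in> D" using D assms by auto
    then have "\<not> u \<le> q" if "u \<in> D" for u using no_bridge[of D u r] D that by blast
    moreover have "u \<in> {p..q} \<or> u \<in> {r..s}" if "u \<in> D" for u using D that by blast
    ultimately have "D \<subseteq> {r..s}" by (auto simp: subset_iff)
    with D show "D = {r..s}" by auto
  qed (use assms in auto)
qed

section \<open>Minimizers are standard nested bubbles\<close>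

text \<open>
  Any weakly increasing family of cuts is carried back to the line by \<open>inv F\<close> and there bounds a bubble
  whose boundary points are among the cuts. Its perimeter is therefore at most the total cost of the
  distinct cuts, while for \<open>E\<close> itself every cut is a boundary point.
\<close>

lemma minimizer_minimal_cuts:
  fixes f :: "real \<Rightarrow> real"
  assumes pos: "is_density f" and dec: "antimono_on {..0} f" and inc: "mono_on {0..} f"
    and F: "strict_mono F" "bij F" "F 0 = 0"
      "\<And>a b. a \<le> b \<Longrightarrow> (f has_integral (F b - F a)) {a..b}"
    and E: "perimeter_minimizing f n V E"
    and x: "strict_mono_on {1..M} x" and bd: "boundary_points n E = x ` {1..M}"
    and cells: "\<And>a. a \<in> {1..n} \<Longrightarrow> E a = cells M c x a"
    and c: "c 0 = 0" "c M = 0"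
  shows "minimal_cuts n M c (\<lambda>k. F (x k)) (\<lambda>u. f (inv F u))"
proof
  have FG: "F (inv F u) = u" for u using F(2) by (simp add: bij_is_surj surj_f_inv_f)
  have GF: "inv F (F u) = u" for u using F(2) by (simp add: bij_is_inj inv_f_f)
  have Fle: "F s \<le> F t \<longleftrightarrow> s \<le> t" for s t using F(1) by (rule strict_mono_less_eq)
  have Gle: "inv F s \<le> inv F t \<longleftrightarrow> s \<le> t" for s t using Fle[of "inv F s" "inv F t"] FG by simp
  have G0: "inv F 0 = 0" using GF[of 0] F(3) by simp
  show "strict_mono_on {1..M} (\<lambda>k. F (x k))"
    using x F(1) by (auto simp: strict_mono_on_def strict_mono_def)
  show "c k \<noteq> c (Suc k)" if "k < M" for k
    using adjacent_colors_differ[OF x bd cells c that] .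
  show "f (inv F u) > 0" for u using pos by (simp add: is_density_def)
  show "f (inv F z) \<le> f (inv F y)" if "y \<le> z" "z \<le> 0" for y z
    using dec that Gle[of y z] Gle[of z 0] G0 by (auto simp: monotone_on_def)
  show "f (inv F y) \<le> f (inv F z)" if "0 \<le> y" "y \<le> z" for y z
    using inc that Gle[of y z] Gle[of 0 y] G0 by (auto simp: monotone_on_def)
  show "(\<Sum>k\<in>{1..M}. f (inv F (F (x k)))) \<le> (\<Sum>u\<in>w ` {1..M}. f (inv F u))"
    if w: "mono_on {1..M} w"
      and vols: "\<And>a. a \<in> {1..n} \<Longrightarrow> color_volume M c w a = color_volume M c (\<lambda>k. F (x k)) a" for w
  proof -
    define z where "z k = inv F (w k)" for k
    have z: "mono_on {1..M} z" using w Gle by (auto simp: z_def mono_on_def)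
    have x': "mono_on {1..M} x" using x by (rule strict_mono_on_imp_mono_on)
    have "volume f (cells M c z a) = V a" if a: "a \<in> {1..n}" for a
    proof -
      have "volume f (cells M c z a) = color_volume M c w a"
        using volume_cells[of f F, OF F(4) z] by (simp add: z_def FG)
      also have "\<dots> = volume f (E a)"
        using volume_cells[of f F, OF F(4) x'] vols[OF a] cells[OF a] by simp
      also have "\<dots> = V a"
        using E a by (simp add: perimeter_minimizing_def is_bubble_with_volumes_def)
      finally show ?thesis .
    qed
    then have "is_bubble_with_volumes f n V (cells M c z)"
      using is_bubble_cells[OF z] by (simp add: is_bubble_with_volumes_def)
    then have le: "perimeter f n E \<le> perimeter f n (cells M c z)"
      using E by (simp add: perimeter_minimizing_def)
    have "perimeter f n E = (\<Sum>k\<in>{1..M}. f (x k))"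
      unfolding perimeter_def bd
      using strict_mono_on_imp_inj_on[OF x] by (subst sum.reindex) (auto simp: comp_def)
    moreover have "perimeter f n (cells M c z) \<le> (\<Sum>u\<in>z ` {1..M}. f u)"
      unfolding perimeter_def
    proof (rule sum_mono2)
      show "boundary_points n (cells M c z) \<subseteq> z ` {1..M}"
        unfolding boundary_points_def using frontier_cells_subset by blast
      show "0 \<le> f u" for u using pos by (simp add: is_density_def less_imp_le)
    qed simp
    moreover have "(\<Sum>u\<in>z ` {1..M}. f u) = (\<Sum>u\<in>w ` {1..M}. f (inv F u))"
    proof -
      have "z ` {1..M} = inv F ` w ` {1..M}" by (simp add: image_image z_def)
      moreover have "inj_on (inv F) (w ` {1..M})" using FG by (intro inj_on_inverseI[where g = F])
      ultimately show ?thesis by (simp add: sum.reindex comp_def)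
    qed
    ultimately show ?thesis using le by (simp add: GF)
  qed
qed (use c in auto)

theorem proposition2p3:
  fixes f :: "real \<Rightarrow> real" and n :: nat and V :: "nat \<Rightarrow> real" and E :: "nat \<Rightarrow> real set"
  assumes "is_density f"
    and "continuous_on UNIV f"
    and "antimono_on {..0} f"
    and "mono_on {0..} f"
    and "n \<ge> 1"
    and "\<forall>a\<in>{1..n}. V a > 0"
    and "mono_on {1..n} V"
    and "perimeter_minimizing f n V E"
  shows "\<exists>m k. m \<ge> 1 \<and> (\<forall>i\<in>{1..m}. k i \<ge> 1) \<and> standard_nested_bubble f n E m k"
proof -
  obtain F where F: "strict_mono F" "bij F" "F 0 = 0" "continuous_on UNIV F"
    "\<And>a b. a \<le> b \<Longrightarrow> (f has_integral (F b - F a)) {a..b}"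
    using volume_coordinate[OF assms(1-4)] by blast
  have bubble: "is_bubble n E" and vol: "\<And>a. a \<in> {1..n} \<Longrightarrow> volume f (E a) = V a"
    using assms(8) by (auto simp: perimeter_minimizing_def is_bubble_with_volumes_def)
  obtain M x c where x: "strict_mono_on {1..M} x" and bd: "boundary_points n E = x ` {1..M}"
    and cells: "\<And>a. a \<in> {1..n} \<Longrightarrow> E a = cells M c x a"
    and c: "c 0 = 0" "c M = 0" "\<And>k. c k \<le> n"
    using bubble_as_cells[OF bubble] by blast
  define v where "v k = F (x k)" for k
  define g where "g u = f (inv F u)" for u
  interpret minimal_cuts n M c v g
    unfolding v_def g_def
    by (rule minimizer_minimal_cuts[OF assms(1,3,4) F(1-3,5) assms(8) x bd cells c(1,2)])
  have GF: "inv F (F u) = u" for u using F(2) by (simp add: bij_is_inj inv_f_f)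
  have less: "x i < x j" if "1 \<le> i" "i < j" "j \<le> M" for i j
    using x that by (auto simp: strict_mono_on_def)
  have le: "x i \<le> x j" if "1 \<le> i" "i \<le> j" "j \<le> M" for i j
    using strict_mono_on_leD[OF x] that by auto
  have "M \<noteq> 0"
  proof
    assume "M = 0"
    then have "E 1 = {}" using cells[of 1] assms(5) by (simp add: cells_def)
    moreover have "0 < V 1" using assms(5) by (intro assms(6)[rule_format]) simp
    ultimately show False using vol[of 1] assms(5) by (simp add: volume_def)
  qed
  then have "0 < M" by simp
  obtain m :: nat and p q :: "nat \<Rightarrow> nat" and K :: "nat \<Rightarrow> nat set" where m: "1 \<le> m"
    and pq: "\<forall>t\<in>{1..m}. Suc (p t) < q t \<and> q t \<le> M"
    and K: "\<forall>t\<in>{1..m}. Suc (p t) \<in> K t \<and> q t \<in> K t \<and> K t \<subseteq> {Suc (p t)..q t}"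
    and disj: "\<forall>s\<in>{1..m}. \<forall>t\<in>{1..m}. s \<noteq> t \<longrightarrow> K s \<inter> K t = {}"
    and cover: "(\<Union>t\<in>{1..m}. K t) = {1..M}"
    and nest: "\<forall>t\<in>{1..<m}. p t < p (Suc t) \<and> q (Suc t) < q t \<and>
       K t \<inter> {Suc (p (Suc t))..q (Suc t)} = {}"
    and inner: "\<forall>t\<in>{2..m}. 1 \<le> p t \<and> q t < M \<and> c (p t) \<noteq> 0 \<and> c (p t) = c (q t)"
    and rep: "\<forall>i j. 1 \<le> i \<and> i < j \<and> j \<le> M \<and> c i = c j \<longrightarrow>
       (\<exists>t\<in>{2..m}. i = p t \<and> j = q t)"
    and rigid: "\<forall>t\<in>{1..m}. \<exists>\<eta>>0. \<forall>d. \<bar>d\<bar> < \<eta> \<longrightarrow>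
       (\<Sum>k\<in>K t. g (v k)) \<le> (\<Sum>k\<in>K t. g (v k + d))"
    using layers[OF \<open>0 < M\<close>] .
  have Ksub: "K t \<subseteq> {1..M}" if "t \<in> {1..m}" for t
    using cover that by blast
  have finK: "finite (x ` K t)" if "t \<in> {1..m}" for t
    using finite_subset[OF Ksub[OF that]] by simp
  \<comment> \<open>Listed from left to right, the cuts of each layer bound the chain \<open>B t\<close> defined below.\<close>
  have "\<forall>t\<in>{1..m}. \<exists>e. strict_mono_on {1..card (x ` K t)} e \<and> x ` K t = e ` {1..card (x ` K t)}"
  proof
    fix t assume "t \<in> {1..m}"
    then have "finite (x ` K t)" by (rule finK)
    then show "\<exists>e. strict_mono_on {1..card (x ` K t)} e \<and> x ` K t = e ` {1..card (x ` K t)}"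
      using finite_linorder_enumeration[of "x ` K t"] by metis
  qed
  from bchoice[OF this] obtain y where y0:
    "\<forall>t\<in>{1..m}. strict_mono_on {1..card (x ` K t)} (y t) \<and>
      x ` K t = y t ` {1..card (x ` K t)}"
    by (elim exE)
  define k where "k t = card (x ` K t) - 1" for t
  define B where "B t a = {y t a..y t (Suc a)}" for t a
  have card: "card (x ` K t) = Suc (k t) \<and> 1 \<le> k t" if t: "t \<in> {1..m}" for t
  proof -
    have "x (Suc (p t)) < x (q t)" using less pq t by auto
    then have "card {x (Suc (p t)), x (q t)} = 2" by simp
    moreover have "card {x (Suc (p t)), x (q t)} \<le> card (x ` K t)"
    proof (rule card_mono)
      show "finite (x ` K t)" using t by (rule finK)
      show "{x (Suc (p t)), x (q t)} \<subseteq> x ` K t" using K t by simp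
    qed
    ultimately show ?thesis by (auto simp: k_def)
  qed
  have y: "strict_mono_on {1..Suc (k t)} (y t)" and yK: "x ` K t = y t ` {1..Suc (k t)}"
    if t: "t \<in> {1..m}" for t
    using y0 card[OF t] t by metis+
  have k1: "1 \<le> k t" if "t \<in> {1..m}" for t using card[OF that] by simp
  have bdB: "boundary_points (k t) (B t) = x ` K t" if t: "t \<in> {1..m}" for t
    using chain_bubble(2)[OF y[OF t] k1[OF t]] yK[OF t] by (simp add: B_def[abs_def])
  have first: "y t 1 = x (Suc (p t))" and last: "y t (Suc (k t)) = x (q t)" if t: "t \<in> {1..m}" for t
  proof -
    have yle: "y t i \<le> y t j" if "1 \<le> i" "i \<le> j" "j \<le> Suc (k t)" for i j
      using strict_mono_on_leD[OF y[OF t]] that by auto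
    have between: "x (Suc (p t)) \<le> u \<and> u \<le> x (q t)" if u: "u \<in> x ` K t" for u
    proof -
      from u obtain l where l: "u = x l" "l \<in> K t" by (rule imageE)
      have "K t \<subseteq> {Suc (p t)..q t}" "q t \<le> M" using K pq t by simp_all
      with l show ?thesis using le[of "Suc (p t)" l] le[of l "q t"] by (auto simp: subset_iff)
    qed
    have all: "y t 1 \<le> u \<and> u \<le> y t (Suc (k t))" if u: "u \<in> x ` K t" for u
    proof -
      from u[unfolded yK[OF t]] obtain s where "u = y t s" "s \<in> {1..Suc (k t)}" by (rule imageE)
      then show ?thesis using yle[of 1 s] yle[of s "Suc (k t)"] by auto
    qed
    have "y t 1 \<in> x ` K t" "y t (Suc (k t)) \<in> x ` K t" using yK[OF t] by auto
    moreover have "x (Suc (p t)) \<in> x ` K t" "x (q t) \<in> x ` K t" using K t by auto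
    ultimately show "y t 1 = x (Suc (p t))" "y t (Suc (k t)) = x (q t)"
      using between all by (meson order_antisym)+
  qed
  have regB: "region (k t) (B t) = {x (Suc (p t))..x (q t)}" if t: "t \<in> {1..m}" for t
    using chain_bubble(3)[OF y[OF t] k1[OF t]] first[OF t] last[OF t] by (simp add: B_def[abs_def])
  have std: "standard_bubble f (k t) (B t)" if t: "t \<in> {1..m}" for t
  proof -
    obtain \<eta> where \<eta>: "\<eta> > 0"
      "\<And>d. \<bar>d\<bar> < \<eta> \<Longrightarrow> (\<Sum>l\<in>K t. g (v l)) \<le> (\<Sum>l\<in>K t. g (v l + d))"
      using rigid t by blast
    have reindex: "(\<Sum>s\<in>{1..Suc (k t)}. h (y t s)) = (\<Sum>l\<in>K t. h (x l))" for h :: "real \<Rightarrow> real"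
    proof -
      have "inj_on (y t) {1..Suc (k t)}" using y[OF t] by (rule strict_mono_on_imp_inj_on)
      then have "(\<Sum>s\<in>{1..Suc (k t)}. h (y t s)) = (\<Sum>u\<in>y t ` {1..Suc (k t)}. h u)"
        by (simp add: sum.reindex comp_def)
      also have "\<dots> = (\<Sum>u\<in>x ` K t. h u)" using yK[OF t] by simp
      also have "inj_on x (K t)"
        using strict_mono_on_imp_inj_on[OF x] Ksub[OF t] inj_on_subset by blast
      then have "(\<Sum>u\<in>x ` K t. h u) = (\<Sum>l\<in>K t. h (x l))"
        by (simp add: sum.reindex comp_def)
      finally show ?thesis .
    qed
    have "in_equilibrium f (k t) (\<lambda>a. {y t a..y t (Suc a)})"
    proof (rule chain_in_equilibrium[OF F(1,4,5) y[OF t] k1[OF t] \<eta>(1)])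
      fix d z assume d: "\<bar>d\<bar> < \<eta>" and z: "\<And>s. s \<in> {1..Suc (k t)} \<Longrightarrow> F (z s) = F (y t s) + d"
      have "(\<Sum>s\<in>{1..Suc (k t)}. f (z s)) = (\<Sum>s\<in>{1..Suc (k t)}. f (inv F (F (y t s) + d)))"
        by (rule sum.cong) (use z GF in \<open>metis+\<close>)
      also have "\<dots> = (\<Sum>l\<in>K t. g (v l + d))"
        using reindex[of "\<lambda>u. f (inv F (F u + d))"] by (simp add: g_def v_def)
      finally show "(\<Sum>s\<in>{1..Suc (k t)}. f (y t s)) \<le> (\<Sum>s\<in>{1..Suc (k t)}. f (z s))"
        using reindex[of f] \<eta>(2)[OF d] by (simp add: g_def v_def GF)
    qed auto
    then show ?thesis
      unfolding standard_bubble_def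
      using chain_bubble[OF y[OF t] k1[OF t]] by (simp add: B_def[abs_def])
  qed
  have inside: "\<exists>C\<in>bubble_components (k t) (B t). region (k (Suc t)) (B (Suc t)) \<subseteq> C"
    if t: "t \<in> {1..<m}" for t
  proof -
    have t1: "t \<in> {1..m}" and t2: "Suc t \<in> {1..m}" using t by auto
    let ?s = "x (Suc (p (Suc t)))" and ?u = "x (q (Suc t))"
    have n: "p t < p (Suc t)" "q (Suc t) < q t" "K t \<inter> {Suc (p (Suc t))..q (Suc t)} = {}"
      using nest t by auto
    have b: "q t \<le> M" "Suc (p (Suc t)) < q (Suc t)" using pq t1 t2 by auto
    have "{?s..?u} \<inter> x ` K t = {}"
    proof -
      have "x l \<notin> {?s..?u}" if l: "l \<in> K t" for l
      proof -
        have lM: "1 \<le> l" "l \<le> M" using Ksub[OF t1] l by auto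
        have "l \<notin> {Suc (p (Suc t))..q (Suc t)}" using n l by auto
        then have "l < Suc (p (Suc t)) \<or> q (Suc t) < l" by auto
        then show ?thesis
          using less[of l "Suc (p (Suc t))"] less[of "q (Suc t)" l] lM n b by auto
      qed
      then show ?thesis by auto
    qed
    then have avoid: "{?s..?u} \<inter> y t ` {1..Suc (k t)} = {}" using yK[OF t1] by simp
    have "y t 1 \<le> ?s" "?s \<le> ?u" "?u \<le> y t (Suc (k t))"
      using first[OF t1] last[OF t1] le[of "Suc (p t)" "Suc (p (Suc t))"]
        le[of "Suc (p (Suc t))" "q (Suc t)"] le[of "q (Suc t)" "q t"] n b by auto
    from chain_bubble_inside_cell[OF y[OF t1] k1[OF t1] this avoid]
    show ?thesis unfolding regB[OF t2] by (simp add: B_def[abs_def])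
  qed
  \<comment> \<open>No third cell has the colour of a pair, so the pair is the whole bubble, and its two cells are
      separated by layer \<open>t\<close>.\<close>
  have flank: "c (p t) \<in> {1..n} \<and> flanks n E (region (k t) (B t)) (c (p t))" if t: "t \<in> {2..m}" for t
  proof
    have t1: "t \<in> {1..m}" using t by auto
    have i: "1 \<le> p t" "q t < M" "c (p t) \<noteq> 0" "c (p t) = c (q t)" and pqt: "Suc (p t) < q t"
      using inner[rule_format, OF t] pq[rule_format, OF t1] by simp_all
    show a: "c (p t) \<in> {1..n}" using i c(3)[of "p t"] by auto
    have ks: "{l. l \<in> {1..<M} \<and> c l = c (p t) \<and> x l < x (Suc l)} = {p t, q t}"
    proof (intro equalityI subsetI)
      fix l assume l: "l \<in> {l. l \<in> {1..<M} \<and> c l = c (p t) \<and> x l < x (Suc l)}"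
      show "l \<in> {p t, q t}"
      proof (rule ccontr)
        assume "l \<notin> {p t, q t}"
        then consider "l < p t" | "p t < l" "l < q t" | "q t < l" by fastforce
        then show False
          using no_color_thrice[of l "p t" "q t"] no_color_thrice[of "p t" l "q t"]
            no_color_thrice[of "p t" "q t" l] l i pqt by cases auto
      qed
    next
      fix l assume "l \<in> {p t, q t}"
      then show "l \<in> {l. l \<in> {1..<M} \<and> c l = c (p t) \<and> x l < x (Suc l)}"
        using i pqt less[of l "Suc l"] by auto
    qed
    let ?C = "{x (p t)..x (Suc (p t))}" and ?D = "{x (q t)..x (Suc (q t))}"
    have EC: "E (c (p t)) = ?C \<union> ?D"
      unfolding cells[OF a] cells_def ks by simp
    have o: "x (p t) < x (Suc (p t))" "x (Suc (p t)) < x (q t)" "x (q t) < x (Suc (q t))"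
      using less i pqt by auto
    have "?C \<in> components (E (c (p t)))" "?D \<in> components (E (c (p t)))"
      unfolding EC
      using components_two_intervals[of "x (p t)" "x (Suc (p t))" "x (q t)" "x (Suc (q t))"] o
      by auto
    then have "?C \<in> bubble_components n E" "?D \<in> bubble_components n E"
      using a by (auto simp: bubble_components_def)
    moreover have "Sup ?C = Inf {x (Suc (p t))..x (q t)}" "Inf ?D = Sup {x (Suc (p t))..x (q t)}"
      using o by auto
    ultimately show "flanks n E (region (k t) (B t)) (c (p t))"
      unfolding flanks_def regB[OF t1] using EC by blast
  qed
  have single: "card (components (E a)) \<le> 1"
    if a: "a \<in> {1..n}" and nf: "\<forall>t\<in>{2..m}. \<not> flanks n E (region (k t) (B t)) a" for a
  proof -
    have unique: "i = j" if "i \<in> {1..<M}" "j \<in> {1..<M}" "c i = a" "c j = a" "i \<le> j" for i j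
    proof (rule ccontr)
      assume "i \<noteq> j"
      then have "\<exists>t\<in>{2..m}. i = p t \<and> j = q t"
        by (intro rep[rule_format]) (use that in auto)
      then show False using flank nf that by blast
    qed
    have "connected (E a)"
    proof (cases "\<exists>i\<in>{1..<M}. c i = a")
      case True
      then obtain i where i: "i \<in> {1..<M}" "c i = a" by blast
      then have only: "l = i" if "l \<in> {1..<M}" "c l = a" for l
        using unique[of l i] unique[of i l] that nat_le_linear[of l i] by metis
      have "x i < x (Suc i)" using i less[of i "Suc i"] by simp
      with i only have "{l. l \<in> {1..<M} \<and> c l = a \<and> x l < x (Suc l)} = {i}"
        by blast
      then show ?thesis unfolding cells[OF a] cells_def by simp
    next
      case False
      then have "E a = {}" unfolding cells[OF a] cells_def by auto
      then show ?thesis by simp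
    qed
    then show ?thesis
      using components_eq_sing_iff[of "E a"] by (cases "E a = {}") auto
  qed
  have "standard_nested_bubble f n E m k"
    unfolding standard_nested_bubble_def
  proof (intro conjI exI[of _ B] ballI impI)
    show "boundary_points n E = (\<Union>i\<in>{1..m}. boundary_points (k i) (B i))"
    proof -
      have "(\<Union>i\<in>{1..m}. boundary_points (k i) (B i)) = x ` (\<Union>i\<in>{1..m}. K i)"
        using bdB by auto
      then show ?thesis using cover bd by simp
    qed
  next
    fix i j assume ij: "i \<in> {1..m}" "j \<in> {1..m}" "i \<noteq> j"
    then have "K i \<inter> K j = {}" using disj by blast
    then show "boundary_points (k i) (B i) \<inter> boundary_points (k j) (B j) = {}"
      unfolding bdB[OF ij(1)] bdB[OF ij(2)]
      using inj_on_image_Int[OF strict_mono_on_imp_inj_on[OF x] Ksub[OF ij(1)] Ksub[OF ij(2)]]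
      by simp
  next
    fix t assume "t \<in> {2..m}"
    then show "\<exists>a\<in>{1..n}. flanks n E (region (k t) (B t)) a" using flank by blast
  qed (use bubble std inside single in auto)
  with m k1 show ?thesis by (intro exI[of _ m] exI[of _ k]) auto
qed

end
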